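(* Let $\varphi$ and $\psi$ be linear fractional self-maps of $\mathbb{D}$ and let $\gamma\geq-1$. Then $C_\varphi-C_\psi$ is compact on $\mathcal{D}_\gamma$ if and only if $\varphi=\psi$ or both $C_\varphi$ and $C_\psi$ are compact on $\mathcal{D}_\gamma$.
   Context: $\mathbb{D}=\{z\in\mathbb{C}:|z|<1\}$. A linear fractional map has the form $\varphi(z)=(az+b)/(cz+d)$ with $a,b,c,d\in\mathbb{C}$ and $ad-bc\neq0$; it is a linear fractional self-map of $\mathbb{D}$ if $\varphi(\mathbb{D})\subseteq\mathbb{D}$. The composition operator is $C_\varphi f=f\circ\varphi$. For $\gamma\ge-1$, the weighted Dirichlet space $\mathcal{D}_\gamma$ is the Hilbert space of analytic functions $f(z)=\sum_{n\ge0}a_nz^n$ on $\mathbb{D}$ with $\|f\|_{\mathcal{D}_\gamma}^2=|a_0|^2+\sum_{n=1}^\infty n^{1-\gamma}|a_n|^2<\infty$. *)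

theory Defs
  imports "HOL-Complex_Analysis.Complex_Analysis"
begin

definition linear_fractional_selfmap :: "(complex \<Rightarrow> complex) \<Rightarrow> bool" where
  \<comment> \<open>Only the values on the disc matter. The condition \<open>c * z + d \<noteq> 0\<close> says that the pole is not
      in the disc: there \<open>moebius\<close> would take the junk value \<open>0\<close> instead of infinity.\<close>
  "linear_fractional_selfmap \<phi> \<longleftrightarrow>
     (\<exists>a b c d. a * d - b * c \<noteq> 0 \<and> (\<forall>z\<in>ball 0 1. c * z + d \<noteq> 0 \<and> \<phi> z = moebius a b c d z)) \<and>
     \<phi> ` ball 0 1 \<subseteq> ball 0 1"

definition taylor_coeff :: "(complex \<Rightarrow> complex) \<Rightarrow> nat \<Rightarrow> complex" where
  "taylor_coeff f n = fps_nth (fps_expansion f 0) n"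

definition dirichlet_space :: "real \<Rightarrow> (complex \<Rightarrow> complex) set" where
  \<comment> \<open>A function on the disc is represented by its extension by \<open>0\<close>, so that two elements are
      equal iff they agree on the disc.\<close>
  "dirichlet_space \<gamma> =
     {f. f holomorphic_on ball 0 1 \<and> (\<forall>z. z \<notin> ball 0 1 \<longrightarrow> f z = 0) \<and>
         summable (\<lambda>n. real (Suc n) powr (1 - \<gamma>) * (cmod (taylor_coeff f (Suc n)))\<^sup>2)}"

definition dirichlet_norm :: "real \<Rightarrow> (complex \<Rightarrow> complex) \<Rightarrow> real" where
  "dirichlet_norm \<gamma> f =
     sqrt ((cmod (taylor_coeff f 0))\<^sup>2 +
           (\<Sum>n. real (Suc n) powr (1 - \<gamma>) * (cmod (taylor_coeff f (Suc n)))\<^sup>2))"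

definition dirichlet_dist :: "real \<Rightarrow> (complex \<Rightarrow> complex) \<Rightarrow> (complex \<Rightarrow> complex) \<Rightarrow> real" where
  \<comment> \<open>\<open>Metric_space\<close> asks for symmetry and nonnegativity outside the carrier too; hence the
      default value.\<close>
  "dirichlet_dist \<gamma> f g =
     (if f \<in> dirichlet_space \<gamma> \<and> g \<in> dirichlet_space \<gamma> then dirichlet_norm \<gamma> (\<lambda>z. f z - g z) else 0)"

abbreviation dirichlet_topology :: "real \<Rightarrow> (complex \<Rightarrow> complex) topology" where
  "dirichlet_topology \<gamma> \<equiv> Metric_space.mtopology (dirichlet_space \<gamma>) (dirichlet_dist \<gamma>)"

definition composition_operator :: "(complex \<Rightarrow> complex) \<Rightarrow> (complex \<Rightarrow> complex) \<Rightarrow> complex \<Rightarrow> complex" where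
  "composition_operator \<phi> f = (\<lambda>z. if z \<in> ball 0 1 then (f \<circ> \<phi>) z else 0)"

definition linear_operator_on_dirichlet ::
    "real \<Rightarrow> ((complex \<Rightarrow> complex) \<Rightarrow> complex \<Rightarrow> complex) \<Rightarrow> bool" where
  "linear_operator_on_dirichlet \<gamma> T \<longleftrightarrow>
     T \<in> dirichlet_space \<gamma> \<rightarrow> dirichlet_space \<gamma> \<and>
     (\<forall>f\<in>dirichlet_space \<gamma>. \<forall>g\<in>dirichlet_space \<gamma>. T (\<lambda>z. f z + g z) = (\<lambda>z. T f z + T g z)) \<and>
     (\<forall>c. \<forall>f\<in>dirichlet_space \<gamma>. T (\<lambda>z. c * f z) = (\<lambda>z. c * T f z))"

definition compact_operator_on_dirichlet ::
    "real \<Rightarrow> ((complex \<Rightarrow> complex) \<Rightarrow> complex \<Rightarrow> complex) \<Rightarrow> bool" where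
  "compact_operator_on_dirichlet \<gamma> T \<longleftrightarrow>
     linear_operator_on_dirichlet \<gamma> T \<and>
     compactin (dirichlet_topology \<gamma>)
       (dirichlet_topology \<gamma> closure_of (T ` {f \<in> dirichlet_space \<gamma>. dirichlet_norm \<gamma> f \<le> 1}))"

text \<open>The norm does define a metric on the space, so \<open>dirichlet_topology\<close> is its norm topology.\<close>

definition dirichlet_term :: "real \<Rightarrow> (complex \<Rightarrow> complex) \<Rightarrow> nat \<Rightarrow> real" where
  "dirichlet_term \<gamma> f n = (if n = 0 then 1 else sqrt (real n powr (1 - \<gamma>))) * cmod (taylor_coeff f n)"

lemma dirichlet_term_nonneg: "0 \<le> dirichlet_term \<gamma> f n"
  by (simp add: dirichlet_term_def)

lemma dirichlet_term_Suc:
  "(dirichlet_term \<gamma> f (Suc n))\<^sup>2 = real (Suc n) powr (1 - \<gamma>) * (cmod (taylor_coeff f (Suc n)))\<^sup>2"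
  by (simp add: dirichlet_term_def power_mult_distrib)

lemma dirichlet_space_iff:
  "f \<in> dirichlet_space \<gamma> \<longleftrightarrow> f holomorphic_on ball 0 1 \<and> (\<forall>z. z \<notin> ball 0 1 \<longrightarrow> f z = 0) \<and>
     summable (\<lambda>n. (dirichlet_term \<gamma> f n)\<^sup>2)"
  by (subst summable_Suc_iff[symmetric]) (simp only: dirichlet_space_def dirichlet_term_Suc mem_Collect_eq)

lemma dirichlet_norm_eq:
  assumes "summable (\<lambda>n. (dirichlet_term \<gamma> f n)\<^sup>2)"
  shows "dirichlet_norm \<gamma> f = sqrt (\<Sum>n. (dirichlet_term \<gamma> f n)\<^sup>2)"
  unfolding suminf_split_head[OF assms, THEN eq_diff_eq[THEN iffD1], symmetric]
  by (simp add: dirichlet_norm_def dirichlet_term_Suc) (simp add: dirichlet_term_def add.commute)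

lemma L2_dirichlet_tendsto:
  assumes "summable (\<lambda>n. (dirichlet_term \<gamma> f n)\<^sup>2)"
  shows "(\<lambda>N. L2_set (dirichlet_term \<gamma> f) {..<N}) \<longlonglongrightarrow> dirichlet_norm \<gamma> f"
  unfolding dirichlet_norm_eq[OF assms] L2_set_def
  using summable_LIMSEQ[OF assms] by (intro tendsto_real_sqrt)

lemma L2_dirichlet_le:
  assumes "summable (\<lambda>n. (dirichlet_term \<gamma> f n)\<^sup>2)"
  shows "L2_set (dirichlet_term \<gamma> f) {..<N} \<le> dirichlet_norm \<gamma> f"
  unfolding dirichlet_norm_eq[OF assms] L2_set_def
  using sum_le_suminf[OF assms] by simp

lemma taylor_coeff_diff:
  assumes "f holomorphic_on ball 0 1" "g holomorphic_on ball 0 1"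
  shows "taylor_coeff (\<lambda>z. f z - g z) n = taylor_coeff f n - taylor_coeff g n"
  using higher_deriv_diff[OF assms open_ball, of 0 n]
  by (simp add: taylor_coeff_def fps_expansion_def diff_divide_distrib)

lemma dirichlet_triangle:
  assumes "\<And>n. cmod (taylor_coeff h n) \<le> cmod (taylor_coeff f n) + cmod (taylor_coeff g n)"
    and f: "summable (\<lambda>n. (dirichlet_term \<gamma> f n)\<^sup>2)" and g: "summable (\<lambda>n. (dirichlet_term \<gamma> g n)\<^sup>2)"
  shows "summable (\<lambda>n. (dirichlet_term \<gamma> h n)\<^sup>2)"
    and "dirichlet_norm \<gamma> h \<le> dirichlet_norm \<gamma> f + dirichlet_norm \<gamma> g"
proof -
  have le: "dirichlet_term \<gamma> h n \<le> dirichlet_term \<gamma> f n + dirichlet_term \<gamma> g n" for n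
    using mult_left_mono[OF assms(1)[of n], of "if n = 0 then 1 else sqrt (real n powr (1 - \<gamma>))"]
    by (simp add: dirichlet_term_def distrib_left)
  have L2: "L2_set (dirichlet_term \<gamma> h) {..<N} \<le> dirichlet_norm \<gamma> f + dirichlet_norm \<gamma> g" for N
  proof -
    have "L2_set (dirichlet_term \<gamma> h) {..<N} \<le>
        L2_set (\<lambda>n. dirichlet_term \<gamma> f n + dirichlet_term \<gamma> g n) {..<N}"
      by (intro L2_set_mono le dirichlet_term_nonneg)
    also have "\<dots> \<le> L2_set (dirichlet_term \<gamma> f) {..<N} + L2_set (dirichlet_term \<gamma> g) {..<N}"
      by (rule L2_set_triangle_ineq)
    also have "\<dots> \<le> dirichlet_norm \<gamma> f + dirichlet_norm \<gamma> g"
      by (intro add_mono L2_dirichlet_le f g)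
    finally show ?thesis .
  qed
  show s: "summable (\<lambda>n. (dirichlet_term \<gamma> h n)\<^sup>2)"
  proof (rule summableI_nonneg_bounded)
    fix N
    have "(L2_set (dirichlet_term \<gamma> h) {..<N})\<^sup>2 \<le> (dirichlet_norm \<gamma> f + dirichlet_norm \<gamma> g)\<^sup>2"
      by (intro power_mono L2 L2_set_nonneg)
    then show "(\<Sum>n<N. (dirichlet_term \<gamma> h n)\<^sup>2) \<le> (dirichlet_norm \<gamma> f + dirichlet_norm \<gamma> g)\<^sup>2"
      by (simp add: L2_set_def sum_nonneg)
  qed simp
  show "dirichlet_norm \<gamma> h \<le> dirichlet_norm \<gamma> f + dirichlet_norm \<gamma> g"
    by (rule LIMSEQ_le_const2[OF L2_dirichlet_tendsto[OF s]]) (use L2 in blast)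
qed

lemma dirichlet_space_diff:
  assumes "f \<in> dirichlet_space \<gamma>" "g \<in> dirichlet_space \<gamma>"
  shows "(\<lambda>z. f z - g z) \<in> dirichlet_space \<gamma>"
proof -
  have "summable (\<lambda>n. (dirichlet_term \<gamma> (\<lambda>z. f z - g z) n)\<^sup>2)"
  proof (rule dirichlet_triangle(1)[of _ f g])
  qed (use assms in \<open>auto simp: dirichlet_space_iff taylor_coeff_diff norm_triangle_ineq4\<close>)
  then show ?thesis
    using assms by (auto simp: dirichlet_space_iff intro!: holomorphic_intros)
qed

lemma dirichlet_norm_eq_0:
  assumes f: "f \<in> dirichlet_space \<gamma>" and "dirichlet_norm \<gamma> f = 0"
  shows "f z = 0"
proof (cases "z \<in> ball 0 1")
  case True
  have s: "summable (\<lambda>n. (dirichlet_term \<gamma> f n)\<^sup>2)" and h: "f holomorphic_on ball 0 1"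
    using f by (auto simp: dirichlet_space_iff)
  have "dirichlet_term \<gamma> f n = 0" for n
    using assms(2) suminf_eq_zero_iff[OF s] by (simp add: dirichlet_norm_eq[OF s])
  then have "\<forall>n. dirichlet_term \<gamma> f n = 0" by blast
  then have "taylor_coeff f n = 0" for n
    by (auto simp: dirichlet_term_def dest!: spec[of _ n] split: if_splits)
  then have "(deriv ^^ n) f 0 = 0" for n
    by (simp add: taylor_coeff_def fps_expansion_def)
  then show ?thesis
    using holomorphic_fun_eq_0_on_ball[OF h True] by simp
qed (use f in \<open>simp add: dirichlet_space_iff\<close>)

lemma Metric_space_dirichlet: "Metric_space (dirichlet_space \<gamma>) (dirichlet_dist \<gamma>)"
proof
  fix f g h :: "complex \<Rightarrow> complex"
  have sq: "dirichlet_dist \<gamma> f g = sqrt (\<Sum>n. (dirichlet_term \<gamma> (\<lambda>z. f z - g z) n)\<^sup>2)"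
    if "f \<in> dirichlet_space \<gamma>" "g \<in> dirichlet_space \<gamma>" for f g
    using that dirichlet_space_diff[OF that]
    by (simp add: dirichlet_dist_def dirichlet_norm_eq dirichlet_space_iff)
  have pos: "0 \<le> (\<Sum>n. (dirichlet_term \<gamma> (\<lambda>z. f z - g z) n)\<^sup>2)"
    if "f \<in> dirichlet_space \<gamma>" "g \<in> dirichlet_space \<gamma>"
    using dirichlet_space_diff[OF that] by (intro suminf_nonneg) (auto simp: dirichlet_space_iff)
  show "0 \<le> dirichlet_dist \<gamma> f g"
    using sq[of f g] pos by (cases "f \<in> dirichlet_space \<gamma> \<and> g \<in> dirichlet_space \<gamma>") (auto simp: dirichlet_dist_def)
  have "dirichlet_term \<gamma> (\<lambda>z. f z - g z) = dirichlet_term \<gamma> (\<lambda>z. g z - f z)"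
    if "f \<in> dirichlet_space \<gamma>" "g \<in> dirichlet_space \<gamma>"
    using that by (auto simp: dirichlet_term_def dirichlet_space_iff taylor_coeff_diff norm_minus_commute fun_eq_iff)
  then show "dirichlet_dist \<gamma> f g = dirichlet_dist \<gamma> g f"
    using sq[of f g] sq[of g f] by (cases "f \<in> dirichlet_space \<gamma> \<and> g \<in> dirichlet_space \<gamma>") (auto simp: dirichlet_dist_def)
  assume f: "f \<in> dirichlet_space \<gamma>" and g: "g \<in> dirichlet_space \<gamma>"
  have "dirichlet_term \<gamma> (\<lambda>z. f z - f z) n = 0" for n
    using f taylor_coeff_diff[of f f n] by (simp add: dirichlet_term_def dirichlet_space_iff)
  then have "dirichlet_dist \<gamma> f f = 0"
    using sq[OF f f] by simp
  moreover have "f = g" if "dirichlet_dist \<gamma> f g = 0"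
    using dirichlet_norm_eq_0[OF dirichlet_space_diff[OF f g]] that f g
    by (auto simp: dirichlet_dist_def fun_eq_iff)
  ultimately show "dirichlet_dist \<gamma> f g = 0 \<longleftrightarrow> f = g" by blast
  assume h: "h \<in> dirichlet_space \<gamma>"
  have hol: "f holomorphic_on ball 0 1" "g holomorphic_on ball 0 1" "h holomorphic_on ball 0 1"
    using f g h by (auto simp: dirichlet_space_iff)
  have "cmod (taylor_coeff f n - taylor_coeff h n) \<le>
      cmod (taylor_coeff f n - taylor_coeff g n) + cmod (taylor_coeff g n - taylor_coeff h n)" for n
    using norm_triangle_ineq[of "taylor_coeff f n - taylor_coeff g n" "taylor_coeff g n - taylor_coeff h n"]
    by simp
  then have "dirichlet_norm \<gamma> (\<lambda>z. f z - h z) \<le>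
      dirichlet_norm \<gamma> (\<lambda>z. f z - g z) + dirichlet_norm \<gamma> (\<lambda>z. g z - h z)"
    using dirichlet_space_diff[OF f g] dirichlet_space_diff[OF g h]
    by (intro dirichlet_triangle(2)) (simp_all only: hol taylor_coeff_diff dirichlet_space_iff)
  then show "dirichlet_dist \<gamma> f h \<le> dirichlet_dist \<gamma> f g + dirichlet_dist \<gamma> g h"
    using f g h by (simp add: dirichlet_dist_def)
qed

end

theory Submission
  imports Defs
begin

text \<open>For the interesting direction let \<open>T = C\<^sub>\<phi> - C\<^sub>\<psi>\<close> be compact. The functions
  \<open>f\<^sub>w(z) = (1 - \<bar>w\<bar>\<^sup>2)\<^bsup>k+1-\<gamma>/2\<^esup> / (1 - cnj w * z)\<^bsup>k+1\<^esup>\<close> are bounded in the space for large \<open>k\<close> and tend to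
  \<open>0\<close> locally uniformly as \<open>\<bar>w\<bar> \<rightarrow> 1\<close>, so \<open>T f\<^sub>w\<close> tends to \<open>0\<close> in norm. The derivative of a function of the
  space grows at most like \<open>(1 - \<bar>z\<bar>\<^sup>2)\<^bsup>-(\<gamma>/2+1)\<^esup>\<close>; applying this to \<open>T f\<^sub>w\<close> at \<open>z\<close> with \<open>w = \<phi> z\<close>, where
  \<open>1 - \<bar>\<phi> z\<bar>\<^sup>2 \<le> M (1 - \<bar>z\<bar>\<^sup>2)\<close>, gives \<open>\<phi>' z - \<psi>' z * Q\<^bsup>k+2\<^esup> \<rightarrow> 0\<close> for
  \<open>Q = (1 - \<bar>\<phi> z\<bar>\<^sup>2) / (1 - cnj (\<phi> z) * \<psi> z)\<close>. Comparing \<open>k\<close> with \<open>k + 1\<close> yields \<open>Q \<rightarrow> 1\<close>, that is,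
  \<open>(\<phi> z - \<psi> z) / (1 - \<bar>\<phi> z\<bar>\<^sup>2) \<rightarrow> 0\<close>.

  If \<open>\<phi>\<close> maps a boundary point \<open>\<zeta>\<close> to the unit circle, let \<open>z\<close> tend to \<open>\<zeta>\<close> along the horocycle
  \<open>1 - \<bar>z\<bar>\<^sup>2 = \<bar>z - \<zeta>\<bar>\<^sup>2\<close>. There \<open>1 - \<bar>\<phi> z\<bar>\<^sup>2\<close> is of the order of \<open>\<bar>z - \<zeta>\<bar>\<^sup>2\<close>, so the numerator of \<open>\<phi> - \<psi>\<close>,
  a quadratic polynomial, is \<open>o(\<bar>z - \<zeta>\<bar>\<^sup>2)\<close> and hence zero. If \<open>\<phi>\<close> does not touch the unit circle, it maps a larger
  disc into a smaller one, and \<open>C\<^sub>\<phi>\<close> is compact by the theorem of Montel and the Cauchy estimates.\<close>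

subsection \<open>Power series and the growth of derivatives\<close>

text \<open>Newton's binomial series with exponent \<open>- of_nat (Suc k)\<close>: negating the
  upper index turns the generalized coefficients into ordinary ones, and the resulting signs cancel
  against those of \<open>(- z) ^ n\<close>.\<close>

lemma binomial_series_sums:
  fixes z :: complex
  assumes "norm z < 1"
  shows "(\<lambda>n. of_nat (n + k choose k) * z ^ n) sums (1 / (1 - z) ^ Suc k)"
proof -
  have "(\<lambda>n. ((- of_nat (Suc k)) gchoose n) * (- z) ^ n) sums (1 + (- z)) powr (- of_nat (Suc k))"
    using gen_binomial_complex[of "- z" "- of_nat (Suc k)"] assms by simp
  moreover have "((- of_nat (Suc k)) gchoose n) * (- z) ^ n = of_nat (n + k choose k) * z ^ n" for n
  proof -
    have "((- of_nat (Suc k) :: complex) gchoose n) = (- 1) ^ n * (of_nat (n + k) gchoose n)"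
      by (subst gbinomial_minus) (simp add: add_ac)
    also have "(of_nat (n + k) gchoose n :: complex) = of_nat (n + k choose k)"
      by (subst binomial_gbinomial[symmetric]) (simp add: binomial_symmetric[of k "n + k"])
    finally have "((- of_nat (Suc k)) gchoose n) * (- z) ^ n =
        of_nat (n + k choose k) * ((- 1) ^ n * (- z) ^ n)"
      by (simp only: mult_ac)
    then show ?thesis
      by (simp flip: power_mult_distrib)
  qed
  moreover have "(1 + (- z)) powr (- of_nat (Suc k)) = 1 / (1 - z) ^ Suc k"
  proof -
    have "1 - z \<noteq> 0"
      using assms by auto
    then show ?thesis
      by (simp only: powr_minus powr_nat diff_conv_add_uminus) (simp add: divide_simps)
  qed
  ultimately show ?thesis by simp
qed

text \<open>Lets a polynomial weight be dominated by binomial coefficients, whose generating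
  function is known in closed form.\<close>

lemma power_le_fact_mult_binomial: "Suc n ^ k \<le> fact k * (n + k choose k)"
proof (induction k)
  case (Suc k)
  have "Suc n ^ Suc k \<le> Suc (n + k) * (fact k * (n + k choose k))"
    using mult_mono[OF _ Suc, of "Suc n" "Suc (n + k)"] by simp
  also have "\<dots> = fact k * (Suc (n + k) * (n + k choose k))"
    by (simp add: algebra_simps)
  also have "Suc (n + k) * (n + k choose k) = Suc k * (Suc (n + k) choose Suc k)"
    using Suc_times_binomial[of k "n + k"] by simp
  finally show ?case
    by (simp add: algebra_simps)
qed simp

text \<open>For real \<open>s\<close> there is no closed form. With
  \<open>x = (n + 1) * (1 - r)\<close> and \<open>k\<close> the ceiling of \<open>s\<close>, the
  bound \<open>x powr s \<le> 1 + x powr k\<close> (first summand for \<open>x \<le> 1\<close>,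
  second otherwise) dominates the series by a geometric and a binomial one, and both scale like
  \<open>(1 - r) powr (- s - 1)\<close>.\<close>

lemma power_weighted_geometric_series:
  fixes s :: real
  assumes "0 \<le> s"
  shows "\<exists>C\<ge>0. \<forall>r. 0 \<le> r \<longrightarrow> r < 1 \<longrightarrow>
    summable (\<lambda>n. real (Suc n) powr s * r ^ n) \<and>
    (\<Sum>n. real (Suc n) powr s * r ^ n) \<le> C * (1 - r) powr (- s - 1)"
proof -
  define k where "k = nat \<lceil>s\<rceil>"
  have sk: "s \<le> real k"
    unfolding k_def by linarith
  show ?thesis
  proof (intro exI[of _ "1 + fact k"] conjI allI impI)
    fix r :: real assume r: "0 \<le> r" "r < 1"
    have term_le: "real (Suc n) powr s * r ^ n \<le> (1 - r) powr (- s) * r ^ n +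
        fact k * (1 - r) powr (real k - s) * (real (n + k choose k) * r ^ n)" for n
    proof -
      define x where "x = real (Suc n) * (1 - r)"
      have x: "0 < x" using r by (simp add: x_def)
      have "x powr s \<le> 1 + x powr k"
      proof (cases "x \<le> 1")
        case True
        then have "x powr s \<le> 1" using x assms powr_le1 by force
        then show ?thesis by (simp add: add_increasing2)
      next
        case False
        then show ?thesis using sk powr_mono[of s k x] by linarith
      qed
      then have "real (Suc n) powr s * (1 - r) powr s \<le> 1 + real (Suc n) powr k * (1 - r) powr k"
        using r by (simp only: x_def powr_mult)
      then have "(1 - r) powr (- s) * (real (Suc n) powr s * (1 - r) powr s) \<le>
          (1 - r) powr (- s) * (1 + real (Suc n) powr k * (1 - r) powr k)"
        by (rule mult_left_mono) simp
      moreover have "(1 - r) powr (- s) * (real (Suc n) powr s * (1 - r) powr s) = real (Suc n) powr s"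
        using r by (simp add: powr_minus)
      moreover have "(1 - r) powr (- s) * (1 + real (Suc n) powr k * (1 - r) powr k) =
          (1 - r) powr (- s) + (1 - r) powr (real k - s) * real (Suc n ^ k)"
        using r powr_realpow[of "real (Suc n)" k]
        by (simp add: powr_diff powr_minus field_simps)
      moreover have "real (Suc n ^ k) \<le> fact k * real (n + k choose k)"
        using power_le_fact_mult_binomial[of n k] by (metis of_nat_fact of_nat_le_iff of_nat_mult)
      then have "(1 - r) powr (real k - s) * real (Suc n ^ k) \<le>
          (1 - r) powr (real k - s) * (fact k * real (n + k choose k))"
        by (intro mult_left_mono) auto
      ultimately have "real (Suc n) powr s \<le> (1 - r) powr (- s) +
          (1 - r) powr (real k - s) * (fact k * real (n + k choose k))"
        by linarith
      then have "real (Suc n) powr s * r ^ n \<le> ((1 - r) powr (- s) +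
          (1 - r) powr (real k - s) * (fact k * real (n + k choose k))) * r ^ n"
        using r by (intro mult_right_mono) auto
      then show ?thesis by (simp add: algebra_simps)
    qed
    \<comment> \<open>The binomial series was proved over the complex numbers; its real version is
      read off from real arguments.\<close>
    have "(\<lambda>n. complex_of_real (real (n + k choose k) * r ^ n)) sums
        complex_of_real (1 / (1 - r) ^ Suc k)"
      using binomial_series_sums[of "of_real r" k] r by simp
    then have bin: "(\<lambda>n. real (n + k choose k) * r ^ n) sums (1 / (1 - r) ^ Suc k)"
      using sums_of_real_iff by blast
    have geo: "(\<lambda>n. r ^ n) sums (1 / (1 - r))"
      using r by (simp add: geometric_sums)
    note sums = sums_add[OF sums_mult[OF geo, of "(1 - r) powr (- s)"]
        sums_mult[OF bin, of "fact k * (1 - r) powr (real k - s)"]]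
    show summable: "summable (\<lambda>n. real (Suc n) powr s * r ^ n)"
      using term_le r by (intro summable_comparison_test'[OF sums_summable[OF sums]]) auto
    have "(\<Sum>n. real (Suc n) powr s * r ^ n) \<le> (1 - r) powr (- s) * (1 / (1 - r)) +
        fact k * (1 - r) powr (real k - s) * (1 / (1 - r) ^ Suc k)"
      unfolding sums_unique[OF sums]
      by (intro suminf_le term_le summable sums_summable[OF sums])
    also have "(1 - r) powr (- s) * (1 / (1 - r)) = (1 - r) powr (- s - 1)"
      using r by (simp add: powr_diff)
    also have "fact k * (1 - r) powr (real k - s) * (1 / (1 - r) ^ Suc k) =
        fact k * (1 - r) powr (- s - 1)"
      using r by (simp add: powr_diff powr_minus powr_realpow field_simps)
    finally show "(\<Sum>n. real (Suc n) powr s * r ^ n) \<le> (1 + fact k) * (1 - r) powr (- s - 1)"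
      by (simp add: algebra_simps)
  qed simp
qed

lemma deriv_taylor_sums:
  assumes "f holomorphic_on ball 0 1" "z \<in> ball 0 1"
  shows "(\<lambda>n. of_nat (Suc n) * taylor_coeff f (Suc n) * z ^ n) sums deriv f z"
proof -
  have "(\<lambda>n. (deriv ^^ n) (deriv f) 0 / fact n * (z - 0) ^ n) sums deriv f z"
    using assms by (intro holomorphic_power_series[of _ _ 1] holomorphic_deriv) auto
  moreover have "(deriv ^^ n) (deriv f) 0 / fact n = of_nat (Suc n) * taylor_coeff f (Suc n)" for n
    by (simp add: taylor_coeff_def fps_expansion_def funpow_Suc_right del: funpow.simps of_nat_Suc)
  ultimately show ?thesis by simp
qed

lemma dirichlet_norm_nonneg: "f \<in> dirichlet_space \<gamma> \<Longrightarrow> 0 \<le> dirichlet_norm \<gamma> f"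
  by (auto simp: dirichlet_space_iff dirichlet_norm_eq intro!: suminf_nonneg)

text \<open>Cauchy-Schwarz on the power series of \<open>deriv f\<close>: one factor is bounded by
  the norm of \<open>f\<close>, the other is a geometric series in \<open>(cmod z)\<^sup>2\<close>
  with weight exponent \<open>1 + \<gamma>\<close>, which is nonnegative by assumption.\<close>

lemma deriv_growth:
  assumes "\<gamma> \<ge> -1"
  shows "\<exists>C\<ge>0. \<forall>f\<in>dirichlet_space \<gamma>. \<forall>z\<in>ball 0 1.
    (1 - (cmod z)\<^sup>2) powr (\<gamma> / 2 + 1) * cmod (deriv f z) \<le> C * dirichlet_norm \<gamma> f"
proof -
  obtain C where C: "0 \<le> C" and bound: "\<And>r. 0 \<le> r \<Longrightarrow> r < 1 \<Longrightarrow>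
      summable (\<lambda>n. real (Suc n) powr (1 + \<gamma>) * r ^ n) \<and>
      (\<Sum>n. real (Suc n) powr (1 + \<gamma>) * r ^ n) \<le> C * (1 - r) powr (- (1 + \<gamma>) - 1)"
    using power_weighted_geometric_series[of "1 + \<gamma>"] assms by auto
  show ?thesis
  proof (intro exI[of _ "sqrt C"] conjI ballI)
    show "0 \<le> sqrt C" using C by simp
    fix f z assume f: "f \<in> dirichlet_space \<gamma>" and z: "z \<in> ball (0 :: complex) 1"
    define q where "q = 1 - (cmod z)\<^sup>2"
    have q: "0 < q" "(cmod z)\<^sup>2 < 1"
      using z by (auto simp: q_def abs_square_less_1)
    define v where "v n = sqrt (real (Suc n) powr (1 + \<gamma>)) * cmod z ^ n" for n
    have v2: "(v n)\<^sup>2 = real (Suc n) powr (1 + \<gamma>) * ((cmod z)\<^sup>2) ^ n" for n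
      by (simp add: v_def power_mult_distrib flip: power_mult) (simp add: mult.commute)
    have hol: "f holomorphic_on ball 0 1" and sf: "summable (\<lambda>n. (dirichlet_term \<gamma> f n)\<^sup>2)"
      using f by (auto simp: dirichlet_space_iff)
    have "cmod (\<Sum>n<N. of_nat (Suc n) * taylor_coeff f (Suc n) * z ^ n) \<le>
        dirichlet_norm \<gamma> f * sqrt (C * q powr (- (1 + \<gamma>) - 1))" for N
    proof -
      \<comment> \<open>The factor \<open>Suc n\<close> from differentiation is split so that one
        part is exactly the square root of the weight in the norm.\<close>
      have "real (Suc n) = sqrt (real (Suc n) powr (1 - \<gamma>)) * sqrt (real (Suc n) powr (1 + \<gamma>))" for n
        by (simp add: powr_add[symmetric] powr_numeral flip: real_sqrt_mult)
      then have "cmod (of_nat (Suc n) * taylor_coeff f (Suc n) * z ^ n) =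
          \<bar>dirichlet_term \<gamma> f (Suc n)\<bar> * \<bar>v n\<bar>" for n
        by (simp add: norm_mult norm_power v_def dirichlet_term_def del: of_nat_Suc)
      then have "cmod (\<Sum>n<N. of_nat (Suc n) * taylor_coeff f (Suc n) * z ^ n) \<le>
          (\<Sum>n<N. \<bar>dirichlet_term \<gamma> f (Suc n)\<bar> * \<bar>v n\<bar>)"
        using norm_sum[of "\<lambda>n. of_nat (Suc n) * taylor_coeff f (Suc n) * z ^ n" "{..<N}"] by simp
      also have "\<dots> \<le> L2_set (\<lambda>n. dirichlet_term \<gamma> f (Suc n)) {..<N} * L2_set v {..<N}"
        by (rule L2_set_mult_ineq)
      also have "\<dots> \<le> dirichlet_norm \<gamma> f * sqrt (C * q powr (- (1 + \<gamma>) - 1))"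
      proof (rule mult_mono)
        have "L2_set (\<lambda>n. dirichlet_term \<gamma> f (Suc n)) {..<N} \<le> L2_set (dirichlet_term \<gamma> f) {..<Suc N}"
          unfolding L2_set_def sum.lessThan_Suc_shift by simp
        then show "L2_set (\<lambda>n. dirichlet_term \<gamma> f (Suc n)) {..<N} \<le> dirichlet_norm \<gamma> f"
          using L2_dirichlet_le[OF sf, of "Suc N"] by linarith
        have "(\<Sum>n<N. (v n)\<^sup>2) \<le> (\<Sum>n. (v n)\<^sup>2)"
          using bound[of "(cmod z)\<^sup>2"] q by (intro sum_le_suminf) (auto simp: v2)
        also have "\<dots> \<le> C * q powr (- (1 + \<gamma>) - 1)"
          using bound[of "(cmod z)\<^sup>2"] q by (simp add: v2 q_def)
        finally show "L2_set v {..<N} \<le> sqrt (C * q powr (- (1 + \<gamma>) - 1))"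
          by (simp add: L2_set_def)
      qed (use dirichlet_norm_nonneg[OF f] in auto)
      finally show ?thesis .
    qed
    then have "cmod (deriv f z) \<le> dirichlet_norm \<gamma> f * sqrt (C * q powr (- (1 + \<gamma>) - 1))"
      using deriv_taylor_sums[OF hol z] unfolding sums_def
      by (intro LIMSEQ_le_const2[OF tendsto_norm]) auto
    also have "sqrt (C * q powr (- (1 + \<gamma>) - 1)) = sqrt C * q powr (- (\<gamma> / 2 + 1))"
    proof -
      have "- (1 + \<gamma>) - 1 = - (\<gamma> / 2 + 1) + - (\<gamma> / 2 + 1)" by simp
      then have "q powr (- (1 + \<gamma>) - 1) = (q powr (- (\<gamma> / 2 + 1)))\<^sup>2"
        by (simp only: power2_eq_square powr_add)
      then show ?thesis by (simp add: real_sqrt_mult)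
    qed
    finally have "q powr (\<gamma> / 2 + 1) * cmod (deriv f z) \<le>
        q powr (\<gamma> / 2 + 1) * (dirichlet_norm \<gamma> f * (sqrt C * q powr (- (\<gamma> / 2 + 1))))"
      by (intro mult_left_mono) auto
    also have "\<dots> = sqrt C * dirichlet_norm \<gamma> f * (q powr (\<gamma> / 2 + 1) * q powr (- (\<gamma> / 2 + 1)))"
      by (simp only: mult_ac)
    also have "q powr (\<gamma> / 2 + 1) * q powr (- (\<gamma> / 2 + 1)) = 1"
      using q by (simp only: powr_minus) simp
    finally show "(1 - (cmod z)\<^sup>2) powr (\<gamma> / 2 + 1) * cmod (deriv f z) \<le> sqrt C * dirichlet_norm \<gamma> f"
      by (simp add: q_def)
  qed
qed

subsection \<open>Test functions\<close>

lemma taylor_coeff_eqI: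
  assumes "\<And>z. z \<in> ball 0 1 \<Longrightarrow> (\<lambda>n. a n * z ^ n) sums f z"
  shows "taylor_coeff f n = a n"
proof -
  have "eventually (\<lambda>z. z \<in> ball (0 :: complex) 1) (nhds 0)"
    by (intro eventually_nhds_in_open) auto
  then have "f has_fps_expansion Abs_fps a"
    by (intro has_fps_expansionI, elim eventually_mono) (simp add: assms)
  then show ?thesis
    using fps_expansion_eqI by (simp add: taylor_coeff_def)
qed

lemma dirichlet_spaceI:
  assumes hol: "f holomorphic_on ball 0 1" and ext: "\<And>z. z \<notin> ball 0 1 \<Longrightarrow> f z = 0"
    and le: "\<And>n. (dirichlet_term \<gamma> f (Suc n))\<^sup>2 \<le> u n" and u: "summable u"
  shows "f \<in> dirichlet_space \<gamma>"
    and "dirichlet_norm \<gamma> f \<le> sqrt ((cmod (taylor_coeff f 0))\<^sup>2 + suminf u)"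
proof -
  have s: "summable (\<lambda>n. (dirichlet_term \<gamma> f (Suc n))\<^sup>2)"
    using le by (intro summable_comparison_test'[OF u]) auto
  then show "f \<in> dirichlet_space \<gamma>"
    using hol ext by (simp add: dirichlet_space_def dirichlet_term_Suc)
  show "dirichlet_norm \<gamma> f \<le> sqrt ((cmod (taylor_coeff f 0))\<^sup>2 + suminf u)"
    using suminf_le[OF le s u] by (simp add: dirichlet_norm_def dirichlet_term_Suc)
qed

text \<open>A normalised power of the kernel \<open>1 / (1 - cnj w * z)\<close>. The squared norm of
  \<open>1 / (1 - cnj w * z) ^ Suc k\<close> may grow like \<open>(1 - (cmod w)\<^sup>2)\<close> to
  the power \<open>- (2 * k + 2 - \<gamma>)\<close>; the exponent in the numerator is half of the
  opposite power.\<close>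

definition test_function :: "real \<Rightarrow> nat \<Rightarrow> complex \<Rightarrow> complex \<Rightarrow> complex" where
  "test_function \<gamma> k w z =
     (if z \<in> ball 0 1
      then of_real ((1 - (cmod w)\<^sup>2) powr (real k + 1 - \<gamma> / 2)) / (1 - cnj w * z) ^ Suc k else 0)"

lemma one_minus_cnj_mult_nonzero: "w \<in> ball 0 1 \<Longrightarrow> z \<in> ball 0 1 \<Longrightarrow> 1 - cnj w * z \<noteq> 0"
  using norm_mult_less[of "cnj w" 1 z 1] by auto

lemma holomorphic_test_function:
  assumes "w \<in> ball 0 1"
  shows "test_function \<gamma> k w holomorphic_on ball 0 1"
proof -
  have "(\<lambda>z. of_real ((1 - (cmod w)\<^sup>2) powr (real k + 1 - \<gamma> / 2)) / (1 - cnj w * z) ^ Suc k)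
      holomorphic_on ball 0 1"
    using one_minus_cnj_mult_nonzero[OF assms] by (intro holomorphic_intros) auto
  then show ?thesis
    by (rule holomorphic_transform) (simp add: test_function_def)
qed

lemma deriv_test_function:
  assumes w: "w \<in> ball 0 1" and z: "z \<in> ball 0 1"
  shows "deriv (test_function \<gamma> k w) z = of_nat (Suc k) * cnj w *
    of_real ((1 - (cmod w)\<^sup>2) powr (real k + 1 - \<gamma> / 2)) / (1 - cnj w * z) ^ (k + 2)"
proof -
  define c where "c = complex_of_real ((1 - (cmod w)\<^sup>2) powr (real k + 1 - \<gamma> / 2))"
  have nz: "1 - cnj w * z \<noteq> 0"
    using one_minus_cnj_mult_nonzero[OF w z] .
  have "((\<lambda>z. c / (1 - cnj w * z) ^ Suc k) has_field_derivative
      of_nat (Suc k) * cnj w * c / (1 - cnj w * z) ^ (k + 2)) (at z)"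
    using nz by (auto intro!: derivative_eq_intros simp: divide_simps power_add power2_eq_square)
      (cases k; simp add: algebra_simps)
  then have "(test_function \<gamma> k w has_field_derivative
      of_nat (Suc k) * cnj w * c / (1 - cnj w * z) ^ (k + 2)) (at z)"
    by (rule has_field_derivative_transform_within_open[OF _ open_ball z])
      (simp add: test_function_def c_def)
  then show ?thesis
    unfolding c_def by (rule DERIV_imp_deriv)
qed

lemma taylor_coeff_test_function:
  assumes w: "w \<in> ball 0 1"
  shows "taylor_coeff (test_function \<gamma> k w) n =
    of_real ((1 - (cmod w)\<^sup>2) powr (real k + 1 - \<gamma> / 2)) * of_nat (n + k choose k) * cnj w ^ n"
proof (rule taylor_coeff_eqI)
  fix z :: complex assume z: "z \<in> ball 0 1"
  have "cmod (cnj w * z) < 1"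
    using norm_mult_less[of "cnj w" 1 z 1] w z by simp
  from sums_mult[OF binomial_series_sums[OF this, of k]]
  show "(\<lambda>n. of_real ((1 - (cmod w)\<^sup>2) powr (real k + 1 - \<gamma> / 2)) * of_nat (n + k choose k) * cnj w ^ n * z ^ n)
      sums test_function \<gamma> k w z"
    using z by (simp add: test_function_def power_mult_distrib mult.assoc del: power_Suc)
qed

text \<open>The Taylor coefficients grow like \<open>n ^ k\<close>, so the squared norm is
  controlled by a geometric series with weight exponent \<open>s = 1 - \<gamma> + 2 * k\<close>. Its
  growth \<open>q powr (- s - 1)\<close> is cancelled by the squared numerator
  \<open>q powr (s + 1)\<close>. The hypothesis says \<open>0 \<le> s\<close>.\<close>

lemma test_function_bounded:
  assumes "0 \<le> 1 - \<gamma> + 2 * real k"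
  shows "\<exists>K>0. \<forall>w\<in>ball 0 1.
    test_function \<gamma> k w \<in> dirichlet_space \<gamma> \<and> dirichlet_norm \<gamma> (test_function \<gamma> k w) \<le> K"
proof -
  define s where "s = 1 - \<gamma> + 2 * real k"
  obtain C where C: "0 \<le> C" and bound: "\<And>r. 0 \<le> r \<Longrightarrow> r < 1 \<Longrightarrow>
      summable (\<lambda>n. real (Suc n) powr s * r ^ n) \<and>
      (\<Sum>n. real (Suc n) powr s * r ^ n) \<le> C * (1 - r) powr (- s - 1)"
    using power_weighted_geometric_series[of s] assms by (auto simp: s_def)
  define D where "D = (real (Suc k) ^ k)\<^sup>2"
  show ?thesis
  proof (intro exI[of _ "sqrt (1 + D * C)"] conjI ballI)
    show "0 < sqrt (1 + D * C)"
      using C by (simp add: D_def add_pos_nonneg)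
    fix w :: complex assume w: "w \<in> ball 0 1"
    let ?f = "test_function \<gamma> k w"
    define q where "q = 1 - (cmod w)\<^sup>2"
    define c where "c = q powr (real k + 1 - \<gamma> / 2)"
    have q: "0 < q" "q \<le> 1" "(cmod w)\<^sup>2 < 1"
      using w by (auto simp: q_def abs_square_less_1)
    have c2: "c\<^sup>2 = q powr (s + 1)"
    proof -
      have "s + 1 = (real k + 1 - \<gamma> / 2) + (real k + 1 - \<gamma> / 2)"
        by (simp add: s_def)
      then show ?thesis
        by (simp only: c_def power2_eq_square powr_add)
    qed
    define u where "u n = c\<^sup>2 * D * (real (Suc n) powr s * ((cmod w)\<^sup>2) ^ n)" for n
    have u: "summable u"
      unfolding u_def using bound[of "(cmod w)\<^sup>2"] q by (intro summable_mult) auto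
    have le: "(dirichlet_term \<gamma> ?f (Suc n))\<^sup>2 \<le> u n" for n
    proof -
      \<comment> \<open>A crude bound on the binomial coefficient, enough because the factor
        \<open>D\<close> depends on \<open>k\<close> alone.\<close>
      have "Suc n + k \<le> Suc k * Suc n"
        by (induction k) auto
      then have "(Suc n + k choose k) \<le> (Suc k * Suc n) ^ k"
        using binomial_le_pow[of k "Suc n + k"] power_mono[of "Suc n + k" "Suc k * Suc n" k]
        by linarith
      then have "real (Suc n + k choose k) \<le> real ((Suc k * Suc n) ^ k)"
        by (rule of_nat_mono)
      then have "(real (Suc n + k choose k))\<^sup>2 \<le> (real ((Suc k * Suc n) ^ k))\<^sup>2"
        by (intro power_mono) auto
      also have "\<dots> = D * real (Suc n) powr (2 * real k)"
        using powr_realpow[of "real (Suc n)" "2 * k"]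
        by (simp only: D_def of_nat_power of_nat_mult power_mult_distrib)
          (simp add: mult.commute flip: power_mult)
      finally have b: "(real (Suc n + k choose k))\<^sup>2 \<le> D * real (Suc n) powr (2 * real k)" .
      have "(dirichlet_term \<gamma> ?f (Suc n))\<^sup>2 =
          real (Suc n) powr (1 - \<gamma>) * (c\<^sup>2 * (real (Suc n + k choose k))\<^sup>2 * ((cmod w)\<^sup>2) ^ Suc n)"
        by (simp only: dirichlet_term_Suc taylor_coeff_test_function[OF w] norm_mult norm_power
            power_mult_distrib complex_mod_cnj norm_of_real norm_of_nat power2_abs c_def q_def
            flip: power_mult mult.assoc) (simp only: mult.commute mult.left_commute)
      \<comment> \<open>One factor \<open>(cmod w)\<^sup>2\<close>, at most 1, is dropped so that
        the index of the power matches the series bounded above.\<close>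
      also have "\<dots> \<le> real (Suc n) powr (1 - \<gamma>) *
          (c\<^sup>2 * (D * real (Suc n) powr (2 * real k)) * ((cmod w)\<^sup>2) ^ n)"
        using q by (intro mult_left_mono mult_mono b power_decreasing) (auto simp: D_def)
      also have "\<dots> = u n"
        by (simp add: u_def s_def powr_add)
      finally show ?thesis .
    qed
    have "?f \<in> dirichlet_space \<gamma>"
      and norm: "dirichlet_norm \<gamma> ?f \<le> sqrt ((cmod (taylor_coeff ?f 0))\<^sup>2 + suminf u)"
      using dirichlet_spaceI[OF holomorphic_test_function[OF w] _ le u]
      by (auto simp: test_function_def)
    show "?f \<in> dirichlet_space \<gamma>" by fact
    have "(cmod (taylor_coeff ?f 0))\<^sup>2 = c\<^sup>2"
      by (simp add: taylor_coeff_test_function[OF w] c_def q_def)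
    also have "\<dots> \<le> 1"
      unfolding c2 using q assms by (intro powr_le1) (auto simp: s_def)
    finally have "(cmod (taylor_coeff ?f 0))\<^sup>2 \<le> 1" .
    moreover have "suminf u \<le> D * C"
    proof -
      have "suminf u = c\<^sup>2 * D * (\<Sum>n. real (Suc n) powr s * ((cmod w)\<^sup>2) ^ n)"
        unfolding u_def using bound[of "(cmod w)\<^sup>2"] q by (intro suminf_mult) auto
      also have "\<dots> \<le> c\<^sup>2 * D * (C * q powr (- s - 1))"
        using bound[of "(cmod w)\<^sup>2"] q by (intro mult_left_mono) (auto simp: q_def D_def)
      also have "\<dots> = D * C * (q powr (s + 1) * q powr (- s - 1))"
        by (simp add: c2)
      also have "q powr (s + 1) * q powr (- s - 1) = 1"
        using q by (simp flip: powr_add)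
      finally show ?thesis by simp
    qed
    ultimately have "sqrt ((cmod (taylor_coeff ?f 0))\<^sup>2 + suminf u) \<le> sqrt (1 + D * C)"
      by (intro real_sqrt_le_mono add_mono)
    with norm show "dirichlet_norm \<gamma> ?f \<le> sqrt (1 + D * C)"
      by linarith
  qed
qed

subsection \<open>Sequential compactness\<close>

text \<open>Bolzano-Weierstrass for relatively compact sets: sequences are tested in
  \<open>S\<close> only, while limits may lie anywhere in \<open>M\<close>.\<close>

lemma (in Metric_space) compactin_closure_of_sequentially:
  assumes "S \<subseteq> M"
  shows "compactin mtopology (mtopology closure_of S) \<longleftrightarrow>
    (\<forall>\<sigma> :: nat \<Rightarrow> 'a. range \<sigma> \<subseteq> S \<longrightarrow>
      (\<exists>l r. l \<in> M \<and> strict_mono r \<and> limitin mtopology (\<sigma> \<circ> r) l sequentially))"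
proof -
  \<comment> \<open>With limits taken in all of \<open>M\<close>, the intersection in the
    Bolzano-Weierstrass property is vacuous.\<close>
  have "M \<inter> mtopology derived_set_of T = mtopology derived_set_of T" for T
    using derived_set_of_subset_topspace[of mtopology T] by auto
  then show ?thesis
    unfolding compact_closure_of_eq_Bolzano_Weierstrass
      Bolzano_Weierstrass_property[OF assms assms]
    using assms by auto
qed

text \<open>Replaces compactness of a closure by extraction of norm convergent subsequences, the
  only form in which compactness is used or proved below.\<close>

lemma compact_operator_on_dirichlet_sequentially:
  "compact_operator_on_dirichlet \<gamma> T \<longleftrightarrow> linear_operator_on_dirichlet \<gamma> T \<and>
     (\<forall>f :: nat \<Rightarrow> _. (\<forall>n. f n \<in> dirichlet_space \<gamma> \<and> dirichlet_norm \<gamma> (f n) \<le> 1) \<longrightarrow>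
       (\<exists>r g. strict_mono r \<and> g \<in> dirichlet_space \<gamma> \<and>
         (\<lambda>n. dirichlet_norm \<gamma> (\<lambda>z. T (f (r n)) z - g z)) \<longlonglongrightarrow> 0))"
proof (cases "linear_operator_on_dirichlet \<gamma> T")
  case True
  interpret Metric_space "dirichlet_space \<gamma>" "dirichlet_dist \<gamma>"
    by (rule Metric_space_dirichlet)
  let ?B = "{f \<in> dirichlet_space \<gamma>. dirichlet_norm \<gamma> f \<le> 1}"
  have maps: "T f \<in> dirichlet_space \<gamma>" if "f \<in> dirichlet_space \<gamma>" for f
    using True that by (auto simp: linear_operator_on_dirichlet_def)
  then have sub: "T ` ?B \<subseteq> dirichlet_space \<gamma>" by blast
  have lim: "limitin mtopology ((\<lambda>n. T (f n)) \<circ> r) g sequentially \<longleftrightarrow> g \<in> dirichlet_space \<gamma> \<and>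
      (\<lambda>n. dirichlet_norm \<gamma> (\<lambda>z. T (f (r n)) z - g z)) \<longlonglongrightarrow> 0"
    if "\<forall>n. f n \<in> ?B" for f g and r :: "nat \<Rightarrow> nat"
    using that maps by (auto simp: limitin_metric_dist_null dirichlet_dist_def)
  \<comment> \<open>A sequence in the image of the unit ball lifts, by choice, to a sequence in the
    ball itself.\<close>
  have image_seq: "(\<forall>\<sigma> :: nat \<Rightarrow> _. range \<sigma> \<subseteq> T ` ?B \<longrightarrow> P \<sigma>) \<longleftrightarrow> (\<forall>f. (\<forall>n. f n \<in> ?B) \<longrightarrow> P (\<lambda>n. T (f n)))"
    for P
  proof (intro iffI allI impI)
    fix \<sigma> :: "nat \<Rightarrow> complex \<Rightarrow> complex"
    assume *: "\<forall>f. (\<forall>n. f n \<in> ?B) \<longrightarrow> P (\<lambda>n. T (f n))" and "range \<sigma> \<subseteq> T ` ?B"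
    then have "\<forall>n. \<exists>f. f \<in> ?B \<and> \<sigma> n = T f" by blast
    then obtain f where f: "\<forall>n. f n \<in> ?B \<and> \<sigma> n = T (f n)" by metis
    then have "\<sigma> = (\<lambda>n. T (f n))" by auto
    then show "P \<sigma>" using * f by blast
  next
    fix f :: "nat \<Rightarrow> complex \<Rightarrow> complex"
    assume *: "\<forall>\<sigma>. range \<sigma> \<subseteq> T ` ?B \<longrightarrow> P \<sigma>" and "\<forall>n. f n \<in> ?B"
    then have "range (\<lambda>n. T (f n)) \<subseteq> T ` ?B" by auto
    then show "P (\<lambda>n. T (f n))" using * by simp
  qed
  have "compactin mtopology (mtopology closure_of (T ` ?B)) \<longleftrightarrow> (\<forall>f :: nat \<Rightarrow> _. (\<forall>n. f n \<in> ?B) \<longrightarrow>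
      (\<exists>l r. l \<in> dirichlet_space \<gamma> \<and> strict_mono r \<and>
        limitin mtopology ((\<lambda>n. T (f n)) \<circ> r) l sequentially))"
    unfolding compactin_closure_of_sequentially[OF sub] 
    by (rule image_seq[of "\<lambda>\<sigma>. \<exists>l r. l \<in> dirichlet_space \<gamma> \<and> strict_mono r \<and>
        limitin mtopology (\<sigma> \<circ> r) l sequentially"])
  also have "\<dots> \<longleftrightarrow> (\<forall>f :: nat \<Rightarrow> _. (\<forall>n. f n \<in> ?B) \<longrightarrow> (\<exists>r g. strict_mono r \<and> g \<in> dirichlet_space \<gamma> \<and>
      (\<lambda>n. dirichlet_norm \<gamma> (\<lambda>z. T (f (r n)) z - g z)) \<longlonglongrightarrow> 0))"
  proof (intro iff_allI imp_cong refl)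
    fix f :: "nat \<Rightarrow> complex \<Rightarrow> complex"
    assume f: "\<forall>n. f n \<in> ?B"
    show "(\<exists>l r. l \<in> dirichlet_space \<gamma> \<and> strict_mono r \<and>
        limitin mtopology ((\<lambda>n. T (f n)) \<circ> r) l sequentially) \<longleftrightarrow>
        (\<exists>r g. strict_mono r \<and> g \<in> dirichlet_space \<gamma> \<and>
          (\<lambda>n. dirichlet_norm \<gamma> (\<lambda>z. T (f (r n)) z - g z)) \<longlonglongrightarrow> 0)"
      unfolding lim[OF f] by blast
  qed
  finally show ?thesis
    using True by (simp add: compact_operator_on_dirichlet_def)
qed (simp add: compact_operator_on_dirichlet_def)

lemma linear_operator_on_dirichlet_diff:
  assumes S: "linear_operator_on_dirichlet \<gamma> S" and T: "linear_operator_on_dirichlet \<gamma> T"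
  shows "linear_operator_on_dirichlet \<gamma> (\<lambda>f z. S f z - T f z)"
  using assms by (auto simp: linear_operator_on_dirichlet_def Pi_iff dirichlet_space_diff fun_eq_iff
      algebra_simps)

lemma dirichlet_norm_diff_le:
  assumes "f \<in> dirichlet_space \<gamma>" "g \<in> dirichlet_space \<gamma>"
  shows "dirichlet_norm \<gamma> (\<lambda>z. f z - g z) \<le> dirichlet_norm \<gamma> f + dirichlet_norm \<gamma> g"
  using assms
  by (intro dirichlet_triangle(2)) (auto simp: dirichlet_space_iff taylor_coeff_diff norm_triangle_ineq4)

text \<open>Two successive extractions: first a subsequence along which \<open>S\<close> converges,
  then a further one along which \<open>T\<close> converges as well.\<close>

lemma compact_operator_on_dirichlet_diff:
  assumes S: "compact_operator_on_dirichlet \<gamma> S" and T: "compact_operator_on_dirichlet \<gamma> T"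
  shows "compact_operator_on_dirichlet \<gamma> (\<lambda>f z. S f z - T f z)"
  unfolding compact_operator_on_dirichlet_sequentially
proof (intro conjI allI impI)
  have linS: "linear_operator_on_dirichlet \<gamma> S" and linT: "linear_operator_on_dirichlet \<gamma> T"
    using assms by (auto simp: compact_operator_on_dirichlet_def)
  then show "linear_operator_on_dirichlet \<gamma> (\<lambda>f z. S f z - T f z)"
    by (rule linear_operator_on_dirichlet_diff)
  fix f :: "nat \<Rightarrow> complex \<Rightarrow> complex"
  assume f: "\<forall>n. f n \<in> dirichlet_space \<gamma> \<and> dirichlet_norm \<gamma> (f n) \<le> 1"
  obtain r g where r: "strict_mono r" "g \<in> dirichlet_space \<gamma>"
      and g: "(\<lambda>n. dirichlet_norm \<gamma> (\<lambda>z. S (f (r n)) z - g z)) \<longlonglongrightarrow> 0"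
    using S f unfolding compact_operator_on_dirichlet_sequentially by blast
  have "\<forall>n. (f \<circ> r) n \<in> dirichlet_space \<gamma> \<and> dirichlet_norm \<gamma> ((f \<circ> r) n) \<le> 1"
    using f by simp
  then obtain r' h where r': "strict_mono r'" "h \<in> dirichlet_space \<gamma>"
      and h: "(\<lambda>n. dirichlet_norm \<gamma> (\<lambda>z. T ((f \<circ> r) (r' n)) z - h z)) \<longlonglongrightarrow> 0"
    using T unfolding compact_operator_on_dirichlet_sequentially by meson
  let ?f = "\<lambda>n. f ((r \<circ> r') n)"
  have mem: "(\<lambda>z. S (?f n) z - g z) \<in> dirichlet_space \<gamma>" "(\<lambda>z. T (?f n) z - h z) \<in> dirichlet_space \<gamma>" for n
    using linS linT f r r' by (auto simp: linear_operator_on_dirichlet_def Pi_iff intro!: dirichlet_space_diff)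
  have eq: "(\<lambda>z. S (?f n) z - T (?f n) z - (g z - h z)) = (\<lambda>z. S (?f n) z - g z - (T (?f n) z - h z))" for n
    by auto
  have "(\<lambda>n. dirichlet_norm \<gamma> (\<lambda>z. S (?f n) z - T (?f n) z - (g z - h z))) \<longlonglongrightarrow> 0"
  proof (rule tendsto_sandwich[OF _ _ tendsto_const])
    show "(\<lambda>n. dirichlet_norm \<gamma> (\<lambda>z. S (?f n) z - g z) + dirichlet_norm \<gamma> (\<lambda>z. T (?f n) z - h z)) \<longlonglongrightarrow> 0"
      using tendsto_add[OF LIMSEQ_subseq_LIMSEQ[OF g r'(1)] h] by (simp add: comp_def)
    show "\<forall>\<^sub>F n in sequentially. 0 \<le> dirichlet_norm \<gamma> (\<lambda>z. S (?f n) z - T (?f n) z - (g z - h z))"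
      unfolding eq by (intro always_eventually allI dirichlet_norm_nonneg dirichlet_space_diff mem)
    show "\<forall>\<^sub>F n in sequentially. dirichlet_norm \<gamma> (\<lambda>z. S (?f n) z - T (?f n) z - (g z - h z)) \<le>
        dirichlet_norm \<gamma> (\<lambda>z. S (?f n) z - g z) + dirichlet_norm \<gamma> (\<lambda>z. T (?f n) z - h z)"
      unfolding eq by (intro always_eventually allI dirichlet_norm_diff_le mem)
  qed
  then show "\<exists>r g. strict_mono r \<and> g \<in> dirichlet_space \<gamma> \<and>
      (\<lambda>n. dirichlet_norm \<gamma> (\<lambda>z. S (f (r n)) z - T (f (r n)) z - g z)) \<longlonglongrightarrow> 0"
    using strict_mono_o[OF r(1) r'(1)] dirichlet_space_diff[OF r(2) r'(2)] by blast
qed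

text \<open>Otherwise some subsequence stays at distance at least \<open>e\<close> from
  \<open>l\<close>. This turns the subsequences supplied by compactness into convergence of the full
  sequence.\<close>

lemma tendsto_if_subseq_tendsto:
  fixes X :: "nat \<Rightarrow> 'a :: metric_space"
  assumes "\<And>s. strict_mono s \<Longrightarrow> \<exists>r :: nat \<Rightarrow> nat. strict_mono r \<and> (\<lambda>n. X (s (r n))) \<longlonglongrightarrow> l"
  shows "X \<longlonglongrightarrow> l"
proof (rule ccontr)
  assume "\<not> X \<longlonglongrightarrow> l"
  then obtain e where e: "e > 0" and "\<not> eventually (\<lambda>n. dist (X n) l < e) sequentially"
    by (auto simp: tendsto_iff)
  then have "infinite {n. \<not> dist (X n) l < e}"
    by (simp add: not_eventually frequently_cofinite flip: cofinite_eq_sequentially)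
  then obtain s :: "nat \<Rightarrow> nat" where s: "strict_mono s" "\<And>n. \<not> dist (X (s n)) l < e"
    using infinite_enumerate by blast
  obtain r where "(\<lambda>n. X (s (r n))) \<longlonglongrightarrow> l"
    using assms[OF s(1)] by blast
  with e s(2) show False
    by (auto simp: tendsto_iff)
qed

section \<open>Derivatives of the images under a compact difference\<close>

lemma taylor_coeff_cmult:
  assumes "f holomorphic_on ball 0 1"
  shows "taylor_coeff (\<lambda>z. c * f z) n = c * taylor_coeff f n"
proof (rule taylor_coeff_eqI)
  fix z :: complex assume "z \<in> ball 0 1"
  then have "(\<lambda>n. taylor_coeff f n * z ^ n) sums f z"
    using holomorphic_power_series[OF assms] by (simp add: taylor_coeff_def fps_expansion_def)
  from sums_mult[OF this, of c] show "(\<lambda>n. c * taylor_coeff f n * z ^ n) sums (c * f z)"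
    by (simp add: mult.assoc)
qed

lemma dirichlet_cmult:
  assumes "f \<in> dirichlet_space \<gamma>"
  shows "(\<lambda>z. c * f z) \<in> dirichlet_space \<gamma>"
    and "dirichlet_norm \<gamma> (\<lambda>z. c * f z) = cmod c * dirichlet_norm \<gamma> f"
proof -
  have hol: "f holomorphic_on ball 0 1" and s: "summable (\<lambda>n. (dirichlet_term \<gamma> f n)\<^sup>2)"
    using assms by (auto simp: dirichlet_space_iff)
  have t: "(dirichlet_term \<gamma> (\<lambda>z. c * f z) n)\<^sup>2 = (cmod c)\<^sup>2 * (dirichlet_term \<gamma> f n)\<^sup>2" for n
    by (simp add: dirichlet_term_def taylor_coeff_cmult[OF hol] norm_mult power_mult_distrib)
  have s': "summable (\<lambda>n. (dirichlet_term \<gamma> (\<lambda>z. c * f z) n)\<^sup>2)"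
    unfolding t by (rule summable_mult[OF s])
  then show "(\<lambda>z. c * f z) \<in> dirichlet_space \<gamma>"
    using assms by (auto simp: dirichlet_space_iff intro!: holomorphic_intros)
  show "dirichlet_norm \<gamma> (\<lambda>z. c * f z) = cmod c * dirichlet_norm \<gamma> f"
    unfolding dirichlet_norm_eq[OF s'] dirichlet_norm_eq[OF s] t suminf_mult[OF s]
    by (simp add: real_sqrt_mult)
qed

lemma composition_operator_has_field_derivative:
  assumes "\<phi> holomorphic_on ball 0 1" "\<phi> ` ball 0 1 \<subseteq> ball 0 1" "f holomorphic_on ball 0 1"
    and z: "z \<in> ball 0 1"
  shows "(composition_operator \<phi> f has_field_derivative deriv f (\<phi> z) * deriv \<phi> z) (at z)"
proof -
  have "(f \<circ> \<phi> has_field_derivative deriv f (\<phi> z) * deriv \<phi> z) (at z)"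
    using assms by (intro DERIV_chain holomorphic_derivI[where S = "ball 0 1"] open_ball) blast+
  then show ?thesis
    by (rule has_field_derivative_transform_within_open[OF _ open_ball z])
      (simp add: composition_operator_def)
qed

text \<open>Along a subsequence the images converge in norm to some \<open>g\<close>, and
  \<open>deriv_growth\<close> turns this into weighted convergence of derivatives at arbitrary, even
  moving, points. Fixed points show \<open>deriv g = 0\<close>; the points \<open>z n\<close> then
  give the claim. Arguing with derivatives means that \<open>g\<close> has to be known only up to a
  constant.\<close>

lemma compact_difference_deriv_tendsto:
  assumes \<gamma>: "\<gamma> \<ge> -1"
    and T: "compact_operator_on_dirichlet \<gamma>
      (\<lambda>f z. composition_operator \<phi> f z - composition_operator \<psi> f z)"
    and \<phi>: "\<phi> holomorphic_on ball 0 1" "\<phi> ` ball 0 1 \<subseteq> ball 0 1"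
    and \<psi>: "\<psi> holomorphic_on ball 0 1" "\<psi> ` ball 0 1 \<subseteq> ball 0 1"
    and f: "\<And>n :: nat. f n \<in> dirichlet_space \<gamma>" "\<And>n. dirichlet_norm \<gamma> (f n) \<le> K"
    and f': "\<And>v. v \<in> ball 0 1 \<Longrightarrow> (\<lambda>n. deriv (f n) v) \<longlonglongrightarrow> 0"
    and z: "\<And>n. z n \<in> ball 0 1"
  shows "(\<lambda>n. (1 - (cmod (z n))\<^sup>2) powr (\<gamma> / 2 + 1) *
    cmod (deriv (f n) (\<phi> (z n)) * deriv \<phi> (z n) - deriv (f n) (\<psi> (z n)) * deriv \<psi> (z n))) \<longlonglongrightarrow> 0"
proof (rule tendsto_if_subseq_tendsto)
  fix s :: "nat \<Rightarrow> nat" assume s: "strict_mono s"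
  let ?T = "\<lambda>f z. composition_operator \<phi> f z - composition_operator \<psi> f z"
  \<comment> \<open>Scales the sequence into the unit ball; adding 1 to \<open>\<bar>K\<bar>\<close>
    keeps the denominator positive. The factor is undone at the end.\<close>
  define c where "c = complex_of_real (1 / (\<bar>K\<bar> + 1))"
  have c: "c \<noteq> 0" "cmod c = 1 / (\<bar>K\<bar> + 1)"
    unfolding c_def norm_of_real of_real_eq_0_iff by auto
  define h where "h n = (\<lambda>z. c * f (s n) z)" for n
  have hol: "f n holomorphic_on ball 0 1" for n
    using f(1) by (simp add: dirichlet_space_iff)
  have h: "h n \<in> dirichlet_space \<gamma>" "dirichlet_norm \<gamma> (h n) \<le> 1" for n
  proof -
    show "h n \<in> dirichlet_space \<gamma>"
      unfolding h_def by (rule dirichlet_cmult(1)[OF f(1)])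
    have "dirichlet_norm \<gamma> (f (s n)) \<le> \<bar>K\<bar> + 1"
      using f(2)[of "s n"] by linarith
    then show "dirichlet_norm \<gamma> (h n) \<le> 1"
      unfolding h_def dirichlet_cmult(2)[OF f(1)] c(2) by simp
  qed
  have holh: "h n holomorphic_on ball 0 1" for n
    using h(1) by (simp add: dirichlet_space_iff)
  have h': "deriv (h n) v = c * deriv (f (s n)) v" if "v \<in> ball 0 1" for n v
    unfolding h_def using that holomorphic_on_imp_differentiable_at[OF hol open_ball] by simp
  obtain r g where r: "strict_mono r" and g: "g \<in> dirichlet_space \<gamma>"
    and lim: "(\<lambda>n. dirichlet_norm \<gamma> (\<lambda>z. ?T (h (r n)) z - g z)) \<longlonglongrightarrow> 0"
    using T h unfolding compact_operator_on_dirichlet_sequentially by meson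
  have Th: "?T (h n) \<in> dirichlet_space \<gamma>" for n
    using T h(1) by (auto simp: compact_operator_on_dirichlet_def linear_operator_on_dirichlet_def)
  have deriv_diff: "deriv (\<lambda>z. ?T (h n) z - g z) v =
      c * (deriv (f (s n)) (\<phi> v) * deriv \<phi> v - deriv (f (s n)) (\<psi> v) * deriv \<psi> v) - deriv g v"
    if v: "v \<in> ball 0 1" for n v
  proof (rule DERIV_imp_deriv)
    have "\<phi> v \<in> ball 0 1" "\<psi> v \<in> ball 0 1"
      using \<phi> \<psi> v by blast+
    moreover have "((\<lambda>z. ?T (h n) z - g z) has_field_derivative
        deriv (h n) (\<phi> v) * deriv \<phi> v - deriv (h n) (\<psi> v) * deriv \<psi> v - deriv g v) (at v)"
      using g v by (intro DERIV_diff composition_operator_has_field_derivative \<phi> \<psi> holh holomorphic_derivI[where S = "ball 0 1"])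
        (auto simp: dirichlet_space_iff)
    ultimately show "((\<lambda>z. ?T (h n) z - g z) has_field_derivative
        c * (deriv (f (s n)) (\<phi> v) * deriv \<phi> v - deriv (f (s n)) (\<psi> v) * deriv \<psi> v) - deriv g v) (at v)"
      by (simp add: h' algebra_simps)
  qed
  obtain C where C: "\<And>f z. f \<in> dirichlet_space \<gamma> \<Longrightarrow> z \<in> ball 0 1 \<Longrightarrow>
      (1 - (cmod z)\<^sup>2) powr (\<gamma> / 2 + 1) * cmod (deriv f z) \<le> C * dirichlet_norm \<gamma> f"
    using deriv_growth[OF \<gamma>] by blast
  \<comment> \<open>Used twice: with a constant sequence to identify \<open>deriv g\<close>, and
    with a subsequence of \<open>z\<close>.\<close>
  have small: "(\<lambda>n. (1 - (cmod (y n))\<^sup>2) powr (\<gamma> / 2 + 1) * cmod (deriv (\<lambda>z. ?T (h (r n)) z - g z) (y n))) \<longlonglongrightarrow> 0"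
    if "\<And>n. y n \<in> ball 0 1" for y
  proof (rule tendsto_sandwich[OF _ _ tendsto_const])
    show "(\<lambda>n. C * dirichlet_norm \<gamma> (\<lambda>z. ?T (h (r n)) z - g z)) \<longlonglongrightarrow> 0"
      using tendsto_mult_right_zero[OF lim] .
  qed (use C[OF dirichlet_space_diff[OF Th g] that] in auto)
  \<comment> \<open>At a fixed point the same sequence tends both to the weighted
    \<open>cmod (deriv g v)\<close> and to 0.\<close>
  have g': "deriv g v = 0" if v: "v \<in> ball 0 1" for v
  proof -
    let ?D = "\<lambda>n. deriv (f (s (r n))) (\<phi> v) * deriv \<phi> v - deriv (f (s (r n))) (\<psi> v) * deriv \<psi> v"
    have "\<phi> v \<in> ball 0 1" "\<psi> v \<in> ball 0 1"
      using \<phi> \<psi> v by blast+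
    then have "(\<lambda>n. c * (deriv (f n) (\<phi> v) * deriv \<phi> v - deriv (f n) (\<psi> v) * deriv \<psi> v)) \<longlonglongrightarrow>
        c * (0 * deriv \<phi> v - 0 * deriv \<psi> v)"
      by (intro tendsto_intros f')
    from LIMSEQ_subseq_LIMSEQ[OF this strict_mono_o[OF s r]]
    have D: "(\<lambda>n. c * ?D n) \<longlonglongrightarrow> 0"
      by (simp add: comp_def)
    have "(\<lambda>n. (1 - (cmod v)\<^sup>2) powr (\<gamma> / 2 + 1) * cmod (c * ?D n - deriv g v)) \<longlonglongrightarrow>
        (1 - (cmod v)\<^sup>2) powr (\<gamma> / 2 + 1) * cmod (0 - deriv g v)"
      by (intro tendsto_intros D)
    moreover have "(\<lambda>n. (1 - (cmod v)\<^sup>2) powr (\<gamma> / 2 + 1) * cmod (c * ?D n - deriv g v)) \<longlonglongrightarrow> 0"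
      using small[of "\<lambda>_. v"] v by (simp only: deriv_diff)
    ultimately have "(1 - (cmod v)\<^sup>2) powr (\<gamma> / 2 + 1) * cmod (0 - deriv g v) = 0"
      by (rule LIMSEQ_unique)
    moreover have "(cmod v)\<^sup>2 < 1"
      using v by (simp add: abs_square_less_1)
    ultimately show ?thesis by simp
  qed
  have "(\<lambda>n. (\<bar>K\<bar> + 1) * ((1 - (cmod (z (s (r n))))\<^sup>2) powr (\<gamma> / 2 + 1) *
      cmod (deriv (\<lambda>z. ?T (h (r n)) z - g z) (z (s (r n)))))) \<longlonglongrightarrow> 0"
    using small[of "\<lambda>n. z (s (r n))"] z by (intro tendsto_mult_right_zero) auto
  moreover have "(\<bar>K\<bar> + 1) * ((1 - (cmod (z (s (r n))))\<^sup>2) powr (\<gamma> / 2 + 1) *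
      cmod (deriv (\<lambda>z. ?T (h (r n)) z - g z) (z (s (r n))))) =
      (1 - (cmod (z (s (r n))))\<^sup>2) powr (\<gamma> / 2 + 1) *
      cmod (deriv (f (s (r n))) (\<phi> (z (s (r n)))) * deriv \<phi> (z (s (r n))) -
        deriv (f (s (r n))) (\<psi> (z (s (r n)))) * deriv \<psi> (z (s (r n))))" for n
    using z by (simp add: deriv_diff g' norm_mult c)
  ultimately show "\<exists>r. strict_mono r \<and> (\<lambda>n. (1 - (cmod (z (s (r n))))\<^sup>2) powr (\<gamma> / 2 + 1) *
      cmod (deriv (f (s (r n))) (\<phi> (z (s (r n)))) * deriv \<phi> (z (s (r n))) -
        deriv (f (s (r n))) (\<psi> (z (s (r n)))) * deriv \<psi> (z (s (r n))))) \<longlonglongrightarrow> 0"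
    using r by (intro exI[of _ r]) simp
qed

subsection \<open>Comparing the two symbols\<close>

text \<open>Both derivatives share one prefactor times a power of
  \<open>(1 - (cmod w)\<^sup>2) / (1 - cnj w * u)\<close>, and this quotient is 1 at
  \<open>u = w\<close>.\<close>

lemma test_function_deriv_difference:
  assumes w: "w \<in> ball 0 1" and v: "v \<in> ball 0 1"
  shows "cmod (deriv (test_function \<gamma> k w) w * x - deriv (test_function \<gamma> k w) v * y) =
    real (Suc k) * cmod w * (1 - (cmod w)\<^sup>2) powr (- (\<gamma> / 2 + 1)) *
    cmod (x - y * (of_real (1 - (cmod w)\<^sup>2) / (1 - cnj w * v)) ^ (k + 2))"
proof -
  define q where "q = 1 - (cmod w)\<^sup>2"
  define e where "e = q powr (- (\<gamma> / 2 + 1))"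
  have q: "0 < q"
    using w by (simp add: q_def abs_square_less_1)
  have qw: "1 - cnj w * w = of_real q"
    by (simp add: q_def complex_norm_square mult.commute del: of_real_power)
  have "real k + 1 - \<gamma> / 2 = real (k + 2) + - (\<gamma> / 2 + 1)"
    by simp
  then have "q powr (real k + 1 - \<gamma> / 2) = q powr real (k + 2) * e"
    unfolding e_def by (simp only: powr_add)
  also have "q powr real (k + 2) = q ^ (k + 2)"
    using q by (rule powr_realpow)
  finally have "deriv (test_function \<gamma> k w) u =
      of_nat (Suc k) * cnj w * (of_real q ^ (k + 2) * of_real e) / (1 - cnj w * u) ^ (k + 2)"
    if "u \<in> ball 0 1" for u
    unfolding deriv_test_function[OF w that] q_def[symmetric] by simp
  then have deriv: "deriv (test_function \<gamma> k w) u =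
      of_nat (Suc k) * cnj w * of_real e * (of_real q / (1 - cnj w * u)) ^ (k + 2)"
    if "u \<in> ball 0 1" for u
    using that by (simp only: power_divide times_divide_eq_right mult_ac)
  have "of_real q / (1 - cnj w * w) = 1"
    using q by (simp add: qw)
  then have "deriv (test_function \<gamma> k w) w * x - deriv (test_function \<gamma> k w) v * y =
      of_nat (Suc k) * cnj w * of_real e * (x - y * (of_real q / (1 - cnj w * v)) ^ (k + 2))"
    unfolding deriv[OF w] deriv[OF v] by (simp only: power_one right_diff_distrib mult_ac mult_1_left)
  then show ?thesis
    unfolding q_def[symmetric] e_def by (simp add: norm_mult del: of_nat_Suc)
qed

lemma tendsto_0_if_mult_bounded_below:
  fixes x y :: "nat \<Rightarrow> real"
  assumes "(\<lambda>n. x n * y n) \<longlonglongrightarrow> 0" "eventually (\<lambda>n. c \<le> x n) sequentially" "c > 0" "\<And>n. 0 \<le> y n"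
  shows "y \<longlonglongrightarrow> 0"
proof (rule tendsto_sandwich[OF _ _ tendsto_const])
  show "(\<lambda>n. 1 / c * (x n * y n)) \<longlonglongrightarrow> 0"
    using tendsto_mult_right_zero[OF assms(1)] .
  show "\<forall>\<^sub>F n in sequentially. y n \<le> 1 / c * (x n * y n)"
    using assms(2)
  proof eventually_elim
    case (elim n)
    then have "c * y n \<le> x n * y n"
      using assms(4)[of n] by (intro mult_right_mono)
    then show ?case
      using \<open>c > 0\<close> by (simp add: field_simps)
  qed
qed (use assms(4) in simp)

text \<open>The constant \<open>M\<close> keeps the weights at \<open>z n\<close> and at
  \<open>\<phi> (z n)\<close> comparable, and the lower bound on \<open>deriv \<phi>\<close>
  prevents the limits obtained for \<open>k\<close> and \<open>k + 1\<close> from being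
  trivial.\<close>

lemma compact_difference_ratio_tendsto:
  assumes \<gamma>: "\<gamma> \<ge> -1"
    and T: "compact_operator_on_dirichlet \<gamma>
      (\<lambda>f z. composition_operator \<phi> f z - composition_operator \<psi> f z)"
    and \<phi>: "\<phi> holomorphic_on ball 0 1" "\<phi> ` ball 0 1 \<subseteq> ball 0 1"
    and \<psi>: "\<psi> holomorphic_on ball 0 1" "\<psi> ` ball 0 1 \<subseteq> ball 0 1"
    and z: "\<And>n :: nat. z n \<in> ball 0 1"
    and lim: "(\<lambda>n. cmod (\<phi> (z n))) \<longlonglongrightarrow> 1"
    and M: "\<And>n. 1 - (cmod (\<phi> (z n)))\<^sup>2 \<le> M * (1 - (cmod (z n))\<^sup>2)"
    and c: "c > 0" "\<And>n. c \<le> cmod (deriv \<phi> (z n))"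
  shows "(\<lambda>n. (\<phi> (z n) - \<psi> (z n)) / of_real (1 - (cmod (\<phi> (z n)))\<^sup>2)) \<longlonglongrightarrow> 0"
proof -
  define w where "w n = \<phi> (z n)" for n
  define v where "v n = \<psi> (z n)" for n
  define q where "q n = 1 - (cmod (w n))\<^sup>2" for n
  define Q where "Q n = of_real (q n) / (1 - cnj (w n) * v n)" for n
  have w: "w n \<in> ball 0 1" and v: "v n \<in> ball 0 1" for n
    using z \<phi>(2) \<psi>(2) unfolding w_def v_def by blast+
  have q: "0 < q n" for n
    using w[of n] by (simp add: q_def abs_square_less_1)
  have nz: "1 - cnj (w n) * v n \<noteq> 0" for n
    using one_minus_cnj_mult_nonzero w v .
  have p: "0 < 1 - (cmod (z n))\<^sup>2" for n
    using z[of n] by (simp add: abs_square_less_1)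
  have Mpos: "0 < M"
    using M[of 0] q[of 0] p[of 0] by (metis less_le_trans q_def w_def zero_less_mult_pos2)
  have limw: "(\<lambda>n. cmod (w n)) \<longlonglongrightarrow> 1"
    using lim by (simp add: w_def)
  then have half: "eventually (\<lambda>n. 1 / 2 \<le> cmod (w n)) sequentially"
    using order_tendstoD(1)[OF limw, of "1 / 2"] by (auto elim: eventually_mono)
  have q0: "q \<longlonglongrightarrow> 0"
    unfolding q_def using tendsto_diff[OF tendsto_const tendsto_power[OF limw, of 2], of 1] by simp
  have E: "(\<lambda>n. deriv \<phi> (z n) - deriv \<psi> (z n) * Q n ^ (k + 2)) \<longlonglongrightarrow> 0"
    if k: "0 \<le> 1 - \<gamma> + 2 * real k" for k
  proof -
    define f where "f n = test_function \<gamma> k (w n)" for n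
    obtain K where f: "f n \<in> dirichlet_space \<gamma>" "dirichlet_norm \<gamma> (f n) \<le> K" for n
      using test_function_bounded[OF k] w unfolding f_def by blast
    \<comment> \<open>For fixed \<open>u\<close> the denominator is bounded below by a power of
      \<open>1 - cmod u\<close>, uniformly in \<open>w n\<close>. The exponent of \<open>q n\<close>
      is at least \<open>1 / 2\<close> by the assumption on \<open>k\<close>.\<close>
    have f': "(\<lambda>n. deriv (f n) u) \<longlonglongrightarrow> 0" if u: "u \<in> ball 0 1" for u
    proof (rule tendsto_norm_zero_cancel, rule tendsto_sandwich[OF _ _ tendsto_const])
      have "(\<lambda>n. q n powr (real k + 1 - \<gamma> / 2)) \<longlonglongrightarrow> 0"
        using q k by (intro tendsto_zero_powrI[OF q0 tendsto_const]) (auto intro!: always_eventually less_imp_le)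
      then show "(\<lambda>n. real (Suc k) / (1 - cmod u) ^ (k + 2) * q n powr (real k + 1 - \<gamma> / 2)) \<longlonglongrightarrow> 0"
        by (rule tendsto_mult_right_zero)
      show "\<forall>\<^sub>F n in sequentially. cmod (deriv (f n) u) \<le>
          real (Suc k) / (1 - cmod u) ^ (k + 2) * q n powr (real k + 1 - \<gamma> / 2)"
      proof (intro always_eventually allI)
        fix n
        have "cmod (cnj (w n) * u) \<le> cmod u"
          using w[of n] mult_right_mono[of "cmod (w n)" 1 "cmod u"] by (simp add: norm_mult)
        then have "1 - cmod u \<le> cmod (1 - cnj (w n) * u)"
          using norm_triangle_ineq2[of 1 "cnj (w n) * u"] by simp
        then have "(1 - cmod u) ^ (k + 2) \<le> cmod (1 - cnj (w n) * u) ^ (k + 2)"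
          using u by (intro power_mono) auto
        moreover have "real (Suc k) * cmod (w n) * q n powr (real k + 1 - \<gamma> / 2) \<le>
            real (Suc k) * 1 * q n powr (real k + 1 - \<gamma> / 2)"
          using w[of n] by (intro mult_right_mono mult_left_mono) auto
        ultimately have "real (Suc k) * cmod (w n) * q n powr (real k + 1 - \<gamma> / 2) / cmod (1 - cnj (w n) * u) ^ (k + 2)
            \<le> real (Suc k) * 1 * q n powr (real k + 1 - \<gamma> / 2) / (1 - cmod u) ^ (k + 2)"
          using u by (intro frac_le) auto
        then show "cmod (deriv (f n) u) \<le>
            real (Suc k) / (1 - cmod u) ^ (k + 2) * q n powr (real k + 1 - \<gamma> / 2)"
          unfolding f_def deriv_test_function[OF w u] q_def
          by (simp add: norm_mult norm_divide norm_power del: of_nat_Suc power_Suc)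
      qed
    qed simp
    \<comment> \<open>Collects the positive prefactor, essentially a power of the ratio of the two
      weights. It is eventually bounded away from 0 and can be divided out.\<close>
    define x where "x n = real (Suc k) * cmod (w n) *
      ((1 - (cmod (z n))\<^sup>2) powr (\<gamma> / 2 + 1) * q n powr (- (\<gamma> / 2 + 1)))" for n
    have "(1 - (cmod (z n))\<^sup>2) powr (\<gamma> / 2 + 1) *
        cmod (deriv (f n) (w n) * deriv \<phi> (z n) - deriv (f n) (v n) * deriv \<psi> (z n)) =
        x n * cmod (deriv \<phi> (z n) - deriv \<psi> (z n) * Q n ^ (k + 2))" for n
      unfolding f_def test_function_deriv_difference[OF w v] x_def q_def Q_def by (simp only: mult_ac)
    then have "(\<lambda>n. x n * cmod (deriv \<phi> (z n) - deriv \<psi> (z n) * Q n ^ (k + 2))) \<longlonglongrightarrow> 0"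
      using compact_difference_deriv_tendsto[where z = z, OF \<gamma> T \<phi> \<psi> f f' z] by (simp add: w_def v_def)
    moreover have "eventually (\<lambda>n. 1 / 2 * (1 / M) powr (\<gamma> / 2 + 1) \<le> x n) sequentially"
      using half
    proof eventually_elim
      case (elim n)
      have "1 / M \<le> (1 - (cmod (z n))\<^sup>2) / q n"
        using M[of n] Mpos q[of n] by (simp add: field_simps w_def q_def)
      then have "(1 / M) powr (\<gamma> / 2 + 1) \<le> ((1 - (cmod (z n))\<^sup>2) / q n) powr (\<gamma> / 2 + 1)"
        using Mpos \<gamma> by (intro powr_mono2) auto
      also have "\<dots> = (1 - (cmod (z n))\<^sup>2) powr (\<gamma> / 2 + 1) * q n powr (- (\<gamma> / 2 + 1))"
        unfolding powr_minus using p[of n] q[of n]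
        by (subst powr_divide) (simp_all only: divide_inverse less_imp_le)
      finally have *: "(1 / M) powr (\<gamma> / 2 + 1) \<le>
          (1 - (cmod (z n))\<^sup>2) powr (\<gamma> / 2 + 1) * q n powr (- (\<gamma> / 2 + 1))" .
      have "1 * (1 / 2) \<le> real (Suc k) * cmod (w n)"
        using elim by (intro mult_mono) auto
      with * show ?case
        unfolding x_def by (intro mult_mono) auto
    qed
    ultimately have "(\<lambda>n. cmod (deriv \<phi> (z n) - deriv \<psi> (z n) * Q n ^ (k + 2))) \<longlonglongrightarrow> 0"
      by (rule tendsto_0_if_mult_bounded_below) (use Mpos in simp_all)
    then show ?thesis
      by (rule tendsto_norm_zero_cancel)
  qed
  \<comment> \<open>Large enough for \<open>E\<close> to apply to both \<open>k\<close> and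
    \<open>Suc k\<close>.\<close>
  define k where "k = nat \<lceil>\<gamma>\<rceil>"
  have k: "\<gamma> \<le> real k"
    unfolding k_def by linarith
  define P where "P n = deriv \<psi> (z n) * Q n ^ (k + 2)" for n
  have E1: "(\<lambda>n. deriv \<phi> (z n) - P n) \<longlonglongrightarrow> 0" and E2: "(\<lambda>n. deriv \<phi> (z n) - P n * Q n) \<longlonglongrightarrow> 0"
    using E[of k] E[of "Suc k"] k \<gamma> by (simp_all add: P_def mult_ac)
  have P_lower: "c / 2 \<le> cmod (P n)" if "cmod (deriv \<phi> (z n) - P n) < c / 2" for n
    using that c(2)[of n] norm_triangle_ineq2[of "deriv \<phi> (z n)" "P n"] by linarith
  \<comment> \<open>Subtracting the two limits isolates \<open>Q n - 1\<close>. By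
    \<open>P_lower\<close> the factor \<open>P n\<close> eventually stays away from 0, which forces
    \<open>Q\<close> to tend to 1.\<close>
  have "(\<lambda>n. P n * (Q n - 1)) \<longlonglongrightarrow> 0"
    using tendsto_diff[OF E1 E2] by (simp add: algebra_simps)
  then have "(\<lambda>n. cmod (P n) * cmod (Q n - 1)) \<longlonglongrightarrow> 0"
    by (auto dest: tendsto_norm_zero simp: norm_mult)
  moreover have "eventually (\<lambda>n. c / 2 \<le> cmod (P n)) sequentially"
    by (rule eventually_mono[OF order_tendstoD(2)[OF tendsto_norm_zero[OF E1], of "c / 2"] P_lower]) (use c(1) in simp)
  ultimately have "(\<lambda>n. cmod (Q n - 1)) \<longlonglongrightarrow> 0"
    by (rule tendsto_0_if_mult_bounded_below) (use c(1) in simp_all)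
  then have "Q \<longlonglongrightarrow> 1"
    by (rule LIM_zero_cancel[OF tendsto_norm_zero_cancel])
  then have "(\<lambda>n. inverse (Q n) - 1) \<longlonglongrightarrow> inverse 1 - 1"
    by (intro tendsto_intros) auto
  \<comment> \<open>Writing \<open>q n\<close> as \<open>1 - cnj (w n) * w n\<close> makes the
    constants cancel and leaves the desired ratio up to the factor \<open>cnj (w n)\<close>.\<close>
  moreover have "inverse (Q n) - 1 = cnj (w n) * ((w n - v n) / of_real (q n))" for n
  proof -
    have "of_real (q n) = 1 - cnj (w n) * w n"
      by (simp add: q_def complex_norm_square mult.commute del: of_real_power)
    then show ?thesis
      using q[of n] nz[of n] by (simp add: Q_def field_simps)
  qed
  ultimately have "(\<lambda>n. cmod (cnj (w n) * ((w n - v n) / of_real (q n)))) \<longlonglongrightarrow> 0"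
    by (intro tendsto_norm_zero) simp
  then have "(\<lambda>n. cmod (w n) * cmod ((w n - v n) / of_real (q n))) \<longlonglongrightarrow> 0"
    by (simp only: norm_mult complex_mod_cnj)
  then have "(\<lambda>n. cmod ((w n - v n) / of_real (q n))) \<longlonglongrightarrow> 0"
    using half by (rule tendsto_0_if_mult_bounded_below) simp_all
  then show ?thesis
    unfolding w_def v_def q_def by (rule tendsto_norm_zero_cancel)
qed

subsection \<open>Boundary behaviour of linear fractional maps\<close>

text \<open>The strict inequality in the open disc passes to the closed disc by continuity as a weak
  one. A zero of the denominator on the circle would then be a zero of the numerator too,
  contradicting the nonzero determinant.\<close>

lemma linear_fractional_selfmapE:
  assumes "linear_fractional_selfmap \<phi>"
  obtains a b c d where "a * d - b * c \<noteq> 0"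
    and "\<And>z. z \<in> ball 0 1 \<Longrightarrow> \<phi> z = (a * z + b) / (c * z + d)"
    and "\<And>z. z \<in> ball 0 1 \<Longrightarrow> cmod (a * z + b) < cmod (c * z + d)"
    and "\<And>z. z \<in> cball 0 1 \<Longrightarrow> cmod (a * z + b) \<le> cmod (c * z + d)"
    and "\<And>z. z \<in> cball 0 1 \<Longrightarrow> c * z + d \<noteq> 0"
proof -
  obtain a b c d where abcd: "a * d - b * c \<noteq> 0"
    and nz: "\<And>z. z \<in> ball 0 1 \<Longrightarrow> c * z + d \<noteq> 0"
    and \<phi>: "\<And>z. z \<in> ball 0 1 \<Longrightarrow> \<phi> z = (a * z + b) / (c * z + d)"
    and self: "\<phi> ` ball 0 1 \<subseteq> ball 0 1"
    using assms unfolding linear_fractional_selfmap_def moebius_def by blast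
  have less: "cmod (a * z + b) < cmod (c * z + d)" if z: "z \<in> ball 0 1" for z
  proof -
    have "\<phi> z \<in> ball 0 1"
      using self z by blast
    then show ?thesis
      using nz[OF z] by (simp add: \<phi>[OF z] norm_divide divide_less_eq)
  qed
  have le: "cmod (a * z + b) \<le> cmod (c * z + d)" if z: "z \<in> cball 0 1" for z
  proof -
    have "continuous_on (closure (ball 0 1)) (\<lambda>z. cmod (a * z + b) - cmod (c * z + d))"
      by (intro continuous_intros)
    then have "cmod (a * z + b) - cmod (c * z + d) \<le> 0"
      by (rule continuous_le_on_closure) (use z less in \<open>auto simp: less_imp_le\<close>)
    then show ?thesis by simp
  qed
  have "c * z + d \<noteq> 0" if z: "z \<in> cball 0 1" for z
  proof
    assume 0: "c * z + d = 0"
    then have "a * z + b = 0"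
      using le[OF z] by simp
    then have "c * (a * z + b) - a * (c * z + d) = 0"
      by (simp add: 0)
    then show False
      using abcd by (simp add: algebra_simps)
  qed
  with abcd \<phi> less le show thesis
    by (rule that)
qed

lemma linear_fractional_selfmapD:
  assumes "linear_fractional_selfmap \<phi>"
  shows "\<phi> holomorphic_on ball 0 1" and "\<phi> ` ball 0 1 \<subseteq> ball 0 1"
proof -
  obtain a b c d where \<phi>: "\<And>z. z \<in> ball 0 1 \<Longrightarrow> \<phi> z = (a * z + b) / (c * z + d)"
    and nz: "\<And>z. z \<in> cball 0 1 \<Longrightarrow> c * z + d \<noteq> 0"
    using assms by (rule linear_fractional_selfmapE) blast
  have "(\<lambda>z. (a * z + b) / (c * z + d)) holomorphic_on ball 0 1"
    using nz by (intro holomorphic_intros) auto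
  then show "\<phi> holomorphic_on ball 0 1"
    by (rule holomorphic_transform) (simp add: \<phi>)
  show "\<phi> ` ball 0 1 \<subseteq> ball 0 1"
    using assms by (simp add: linear_fractional_selfmap_def)
qed

lemma horocycle_sequence:
  assumes "cmod \<zeta> = 1"
  obtains z :: "nat \<Rightarrow> complex" where "\<And>n. z n \<in> ball 0 1" "\<And>n. z n \<noteq> \<zeta>" "z \<longlonglongrightarrow> \<zeta>"
    "\<And>n. 1 - (cmod (z n))\<^sup>2 = (cmod (z n - \<zeta>))\<^sup>2"
proof
  \<comment> \<open>Inversion sends the line with real part 1 to the circle where
    \<open>Re u = (cmod u)\<^sup>2\<close>. On it
    \<open>1 - (cmod (1 - u))\<^sup>2 = 2 * Re u - (cmod u)\<^sup>2\<close> equals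
    \<open>(cmod u)\<^sup>2\<close>.\<close>
  define u where "u n = 1 / (1 + \<i> * of_nat n)" for n
  have nz: "1 + \<i> * of_nat n \<noteq> 0" for n
    by (simp add: complex_eq_iff)
  then have u0: "u n \<noteq> 0" for n
    by (simp add: u_def)
  have u: "1 - (cmod (1 - u n))\<^sup>2 = (cmod (u n))\<^sup>2" for n
  proof -
    have pos: "0 < 1 + (real n)\<^sup>2"
      by (simp add: add_pos_nonneg)
    have "Re (u n) = 1 / (1 + (real n)\<^sup>2)" "Im (u n) = - real n / (1 + (real n)\<^sup>2)"
      by (simp_all add: u_def Re_divide Im_divide power2_eq_square)
    then have "(Re (u n))\<^sup>2 + (Im (u n))\<^sup>2 = (1 + (real n)\<^sup>2) / (1 + (real n)\<^sup>2)\<^sup>2"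
      by (simp add: power_divide add_divide_distrib)
    also have "\<dots> = Re (u n)"
      using pos \<open>Re (u n) = _\<close> by (simp add: power2_eq_square)
    finally show ?thesis
      unfolding cmod_power2 by (simp add: power2_eq_square algebra_simps)
  qed
  let ?z = "\<lambda>n. \<zeta> * (1 - u n)"
  have "?z n - \<zeta> = - (\<zeta> * u n)" for n
    by (simp add: algebra_simps)
  then have norm: "cmod (?z n) = cmod (1 - u n)" "cmod (?z n - \<zeta>) = cmod (u n)" for n
    using assms by (simp_all only: norm_mult norm_minus_cancel mult_1_left)
  show "1 - (cmod (?z n))\<^sup>2 = (cmod (?z n - \<zeta>))\<^sup>2" for n
    unfolding norm by (rule u)
  then have "(cmod (?z n))\<^sup>2 < 1" for n
    using u0[of n] norm(2)[of n] by (smt (verit) norm_eq_zero zero_less_power2)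
  then show "?z n \<in> ball 0 1" for n
    by (simp add: abs_square_less_1)
  show "?z n \<noteq> \<zeta>" for n
    using u0[of n] norm(2)[of n] by auto
  have "filterlim (\<lambda>n. 1 + \<i> * of_nat n) at_infinity sequentially"
    by (intro tendsto_add_filterlim_at_infinity[OF tendsto_const] tendsto_mult_filterlim_at_infinity[OF tendsto_const]
        tendsto_of_nat) auto
  then have "u \<longlonglongrightarrow> 0"
    unfolding u_def by (intro tendsto_divide_0[OF tendsto_const])
  then have "?z \<longlonglongrightarrow> \<zeta> * (1 - 0)"
    by (intro tendsto_intros)
  then show "?z \<longlonglongrightarrow> \<zeta>" by simp
qed

text \<open>The Hermitian form \<open>\<bar>c z + d\<bar>\<^sup>2 - \<bar>a z + b\<bar>\<^sup>2\<close> is nonnegative on the unit circle and vanishes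
  at \<open>\<zeta>\<close>, so its tangential derivative there vanishes too; on the horocycle it is therefore of the order
  of the squared distance to \<open>\<zeta>\<close>.\<close>

lemma horocycle_boundary_distance:
  fixes a b c d \<zeta> :: complex
  assumes le: "\<And>z. cmod z = 1 \<Longrightarrow> cmod (a * z + b) \<le> cmod (c * z + d)"
    and \<zeta>: "cmod \<zeta> = 1" "cmod (a * \<zeta> + b) = cmod (c * \<zeta> + d)"
  obtains C where "C > 0" "\<And>z. 1 - (cmod z)\<^sup>2 = (cmod (z - \<zeta>))\<^sup>2 \<Longrightarrow>
    (cmod (c * z + d))\<^sup>2 - (cmod (a * z + b))\<^sup>2 \<le> C * (cmod (z - \<zeta>))\<^sup>2"
proof -
  define A where "A = (cmod c)\<^sup>2 - (cmod a)\<^sup>2"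
  define B where "B = c * cnj d - a * cnj b"
  define D where "D = (cmod d)\<^sup>2 - (cmod b)\<^sup>2"
  have affine: "(cmod (p * z + q))\<^sup>2 = (cmod p)\<^sup>2 * (cmod z)\<^sup>2 + 2 * Re (p * cnj q * z) + (cmod q)\<^sup>2"
    for p q z
    unfolding cmod_power2 by (simp add: power2_eq_square algebra_simps)
  have N: "(cmod (c * z + d))\<^sup>2 - (cmod (a * z + b))\<^sup>2 = A * (cmod z)\<^sup>2 + 2 * Re (B * z) + D" for z
    unfolding affine by (simp add: A_def B_def D_def algebra_simps)
  \<comment> \<open>Rotates the contact point to 1: on the circle \<open>z = \<zeta> * v\<close>,
    the linear part of the form becomes \<open>2 * Re (\<beta> * v)\<close>.\<close>
  define \<beta> where "\<beta> = B * \<zeta>"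
  have zero: "A + 2 * Re \<beta> + D = 0"
    using N[of \<zeta>] \<zeta> by (simp add: \<beta>_def)
  have min: "Re \<beta> \<le> Re (\<beta> * v)" if "cmod v = 1" for v
  proof -
    have unit: "cmod (\<zeta> * v) = 1"
      using \<zeta>(1) that by (simp add: norm_mult)
    then have "(cmod (a * (\<zeta> * v) + b))\<^sup>2 \<le> (cmod (c * (\<zeta> * v) + d))\<^sup>2"
      by (intro power_mono le) auto
    then have "0 \<le> A + 2 * Re (B * (\<zeta> * v)) + D"
      using N[of "\<zeta> * v"] unfolding unit one_power2 mult_1_right by linarith
    then show ?thesis
      using zero by (simp add: \<beta>_def mult.assoc)
  qed
  \<comment> \<open>This is the vanishing tangential derivative: \<open>Re (\<beta> * v)\<close> is
    minimal over the circle at \<open>v = 1\<close>, and testing with the \<open>v\<close> that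
    makes \<open>\<beta> * v = - cmod \<beta>\<close> shows that \<open>\<beta>\<close> is real and
    nonpositive.\<close>
  have \<beta>: "\<beta> = - of_real (cmod \<beta>)"
  proof (cases "\<beta> = 0")
    case False
    have "\<beta> * (- cnj \<beta> / of_real (cmod \<beta>)) = - of_real (cmod \<beta>)"
    proof -
      have "\<beta> * cnj \<beta> = of_real (cmod \<beta>) * of_real (cmod \<beta>)"
        by (metis complex_norm_square of_real_mult power2_eq_square)
      then show ?thesis
        using False by (simp only: times_divide_eq_right mult_minus_right) simp
    qed
    moreover have "cmod (- cnj \<beta> / of_real (cmod \<beta>)) = 1"
      using False by (simp add: norm_divide)
    ultimately have "Re \<beta> \<le> - cmod \<beta>"
      using min[of "- cnj \<beta> / of_real (cmod \<beta>)"] by simp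
    then have "(cmod \<beta>)\<^sup>2 \<le> (Re \<beta>)\<^sup>2"
      by (simp add: abs_le_square_iff[symmetric])
    then have "Im \<beta> = 0"
      by (simp add: cmod_power2)
    then show ?thesis
      using \<open>Re \<beta> \<le> - cmod \<beta>\<close> abs_Re_le_cmod[of \<beta>] by (auto simp: complex_eq_iff)
  qed simp
  show thesis
  proof
    \<comment> \<open>On the horocycle the form equals \<open>2 * cmod \<beta> - A\<close> times the
      squared distance; this constant is a positive upper bound for that coefficient.\<close>
    show "0 < \<bar>A\<bar> + 2 * cmod \<beta> + 1" by (intro add_nonneg_pos) auto
    fix z assume z: "1 - (cmod z)\<^sup>2 = (cmod (z - \<zeta>))\<^sup>2"
    have Bz: "B * z = \<beta> * (cnj \<zeta> * z)"
    proof -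
      have "\<zeta> * cnj \<zeta> = 1"
        using \<zeta>(1) complex_norm_square[of \<zeta>] by simp
      then show ?thesis
        by (simp add: \<beta>_def)
    qed
    have "(cmod (z - \<zeta>))\<^sup>2 = (cmod z)\<^sup>2 - 2 * Re (cnj \<zeta> * z) + (cmod \<zeta>)\<^sup>2"
      unfolding cmod_power2 by (simp add: power2_eq_square algebra_simps)
    then have Re: "Re (cnj \<zeta> * z) = 1 - (cmod (z - \<zeta>))\<^sup>2"
      using z \<zeta>(1) by simp
    have ReB: "Re (B * z) = - cmod \<beta> * (1 - (cmod (z - \<zeta>))\<^sup>2)"
      unfolding Bz Re[symmetric] by (subst \<beta>) simp
    have "Re \<beta> = - cmod \<beta>"
      by (subst \<beta>) simp
    then have D: "D = 2 * cmod \<beta> - A"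
      using zero by linarith
    have "(cmod z)\<^sup>2 = 1 - (cmod (z - \<zeta>))\<^sup>2"
      using z by simp
    then have "(cmod (c * z + d))\<^sup>2 - (cmod (a * z + b))\<^sup>2 = (2 * cmod \<beta> - A) * (cmod (z - \<zeta>))\<^sup>2"
      unfolding N ReB D by (simp only:) (simp add: algebra_simps)
    also have "\<dots> \<le> (\<bar>A\<bar> + 2 * cmod \<beta> + 1) * (cmod (z - \<zeta>))\<^sup>2"
    proof (rule mult_right_mono)
      show "2 * cmod \<beta> - A \<le> \<bar>A\<bar> + 2 * cmod \<beta> + 1" by linarith
    qed simp
    finally show "(cmod (c * z + d))\<^sup>2 - (cmod (a * z + b))\<^sup>2 \<le> (\<bar>A\<bar> + 2 * cmod \<beta> + 1) * (cmod (z - \<zeta>))\<^sup>2" .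
  qed
qed

text \<open>The coefficients are removed one at a time: multiplying the quotient by
  \<open>(h n)\<^sup>2\<close>, by \<open>h n\<close> and by 1 isolates \<open>p\<close>,
  \<open>q\<close> and \<open>r\<close> in the limit.\<close>

lemma quadratic_eq_0_if_tendsto:
  fixes h :: "nat \<Rightarrow> complex"
  assumes h: "h \<longlonglongrightarrow> 0" "\<And>n. h n \<noteq> 0"
    and lim: "(\<lambda>n. (p + q * h n + r * (h n)\<^sup>2) / (h n)\<^sup>2) \<longlonglongrightarrow> 0"
  shows "p = 0 \<and> q = 0 \<and> r = 0"
proof -
  have "(\<lambda>n. (p + q * h n + r * (h n)\<^sup>2) / (h n)\<^sup>2 * (h n)\<^sup>2) \<longlonglongrightarrow> 0 * 0\<^sup>2"
    by (intro tendsto_intros lim h)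
  then have "(\<lambda>n. p + q * h n + r * (h n)\<^sup>2) \<longlonglongrightarrow> 0"
    using h(2) by simp
  moreover have "(\<lambda>n. p + q * h n + r * (h n)\<^sup>2) \<longlonglongrightarrow> p + q * 0 + r * 0\<^sup>2"
    by (intro tendsto_intros h)
  ultimately have p: "p = 0"
    using LIMSEQ_unique by fastforce
  have "(\<lambda>n. (p + q * h n + r * (h n)\<^sup>2) / (h n)\<^sup>2 * h n) \<longlonglongrightarrow> 0 * 0"
    by (intro tendsto_intros lim h)
  moreover have "(p + q * h n + r * (h n)\<^sup>2) / (h n)\<^sup>2 * h n = q + r * h n" for n
    using h(2)[of n] by (simp add: p power2_eq_square field_simps)
  ultimately have "(\<lambda>n. q + r * h n) \<longlonglongrightarrow> 0"
    by simp
  moreover have "(\<lambda>n. q + r * h n) \<longlonglongrightarrow> q + r * 0"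
    by (intro tendsto_intros h)
  ultimately have q: "q = 0"
    using LIMSEQ_unique by fastforce
  have "(\<lambda>n. r) \<longlonglongrightarrow> 0"
    using lim h(2) by (simp add: p q)
  then show ?thesis
    using p q by (simp add: LIMSEQ_const_iff)
qed

lemma moebius_has_field_derivative:
  fixes a b c d z :: complex
  assumes "c * z + d \<noteq> 0"
  shows "((\<lambda>z. (a * z + b) / (c * z + d)) has_field_derivative (a * d - b * c) / (c * z + d)\<^sup>2) (at z)"
  using assms by (auto intro!: derivative_eq_intros simp: power2_eq_square) (simp add: algebra_simps)

lemma norm_affine_le:
  fixes c d z :: complex
  assumes "cmod z \<le> 1"
  shows "cmod (c * z + d) \<le> cmod c + cmod d"
proof -
  have "cmod (c * z + d) \<le> cmod c * cmod z + cmod d"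
    using norm_triangle_ineq[of "c * z" d] by (simp add: norm_mult)
  also have "cmod c * cmod z \<le> cmod c * 1"
    using assms by (intro mult_left_mono) auto
  finally show ?thesis by simp
qed

text \<open>The horocycle through \<open>\<zeta>\<close> supplies every hypothesis of
  \<open>compact_difference_ratio_tendsto\<close>. The ratio then controls the cross-multiplied
  numerator of \<open>\<phi> - \<psi>\<close>, which has degree at most two and cannot be of smaller
  order than the squared distance to \<open>\<zeta>\<close> unless it vanishes.\<close>

lemma eq_if_compact_difference_contact:
  fixes a b c d \<zeta> :: complex
  assumes \<gamma>: "\<gamma> \<ge> -1"
    and T: "compact_operator_on_dirichlet \<gamma>
      (\<lambda>f z. composition_operator \<phi> f z - composition_operator \<psi> f z)"
    and self: "linear_fractional_selfmap \<phi>" "linear_fractional_selfmap \<psi>"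
    and abcd: "a * d - b * c \<noteq> 0"
    and \<phi>: "\<And>z. z \<in> ball 0 1 \<Longrightarrow> \<phi> z = (a * z + b) / (c * z + d)"
    and le: "\<And>z. z \<in> cball 0 1 \<Longrightarrow> cmod (a * z + b) \<le> cmod (c * z + d)"
    and nz: "\<And>z. z \<in> cball 0 1 \<Longrightarrow> c * z + d \<noteq> 0"
    and \<zeta>: "cmod \<zeta> = 1" "cmod (a * \<zeta> + b) = cmod (c * \<zeta> + d)"
  shows "\<forall>z\<in>ball 0 1. \<phi> z = \<psi> z"
proof -
  obtain a' b' c' d' where \<psi>: "\<And>z. z \<in> ball 0 1 \<Longrightarrow> \<psi> z = (a' * z + b') / (c' * z + d')"
    and nz': "\<And>z. z \<in> cball 0 1 \<Longrightarrow> c' * z + d' \<noteq> 0"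
    using self(2) by (rule linear_fractional_selfmapE) blast
  obtain z where z: "\<And>n :: nat. z n \<in> ball 0 1" "\<And>n. z n \<noteq> \<zeta>" "z \<longlonglongrightarrow> \<zeta>"
    and horo: "\<And>n. 1 - (cmod (z n))\<^sup>2 = (cmod (z n - \<zeta>))\<^sup>2"
    using horocycle_sequence[OF \<zeta>(1)] by blast
  have zc: "z n \<in> cball 0 1" "cmod (z n) \<le> 1" for n
    using z(1)[of n] by auto
  have \<zeta>c: "\<zeta> \<in> cball 0 1"
    using \<zeta>(1) by simp
  obtain C where C: "C > 0" and form: "\<And>n. (cmod (c * z n + d))\<^sup>2 - (cmod (a * z n + b))\<^sup>2 \<le> C * (cmod (z n - \<zeta>))\<^sup>2"
  proof (rule horocycle_boundary_distance[of a b c d \<zeta>])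
    show "cmod (a * u + b) \<le> cmod (c * u + d)" if "cmod u = 1" for u
      using that by (intro le) simp
  qed (use \<zeta> horo that in blast)+
  have "continuous_on (cball 0 1) (\<lambda>z. cmod (c * z + d))"
    by (intro continuous_intros)
  then obtain z0 where z0: "z0 \<in> cball 0 1" "\<And>z. z \<in> cball 0 1 \<Longrightarrow> cmod (c * z0 + d) \<le> cmod (c * z + d)"
    using continuous_attains_inf[of "cball (0 :: complex) 1"] by fastforce
  \<comment> \<open>The minimum of the denominator over the closed disc, positive because the pole
    lies outside.\<close>
  define m where "m = cmod (c * z0 + d)"
  have m: "0 < m" "\<And>n. m \<le> cmod (c * z n + d)"
    using nz[OF z0(1)] z0(2) zc by (auto simp: m_def)
  have dist: "1 - (cmod (\<phi> (z n)))\<^sup>2 \<le> C / m\<^sup>2 * (1 - (cmod (z n))\<^sup>2)" for n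
  proof -
    have pos: "0 < (cmod (c * z n + d))\<^sup>2"
      using nz[OF zc(1)] by simp
    have "1 - (cmod (\<phi> (z n)))\<^sup>2 = ((cmod (c * z n + d))\<^sup>2 - (cmod (a * z n + b))\<^sup>2) / (cmod (c * z n + d))\<^sup>2"
      using pos by (simp add: \<phi>[OF z(1)] norm_divide power_divide diff_divide_distrib)
    also have "\<dots> \<le> C * (cmod (z n - \<zeta>))\<^sup>2 / (cmod (c * z n + d))\<^sup>2"
      by (intro divide_right_mono form) simp
    also have "\<dots> \<le> C * (cmod (z n - \<zeta>))\<^sup>2 / m\<^sup>2"
      using C m by (intro divide_left_mono power_mono mult_pos_pos pos) auto
    finally show ?thesis
      by (simp add: horo)
  qed
  have lim: "(\<lambda>n. cmod (\<phi> (z n))) \<longlonglongrightarrow> 1"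
  proof -
    have "(\<lambda>n. cmod ((a * z n + b) / (c * z n + d))) \<longlonglongrightarrow> cmod ((a * \<zeta> + b) / (c * \<zeta> + d))"
      by (intro tendsto_intros z(3) nz[OF \<zeta>c])
    moreover have "cmod ((a * \<zeta> + b) / (c * \<zeta> + d)) = 1"
      using \<zeta>(2) nz[OF \<zeta>c] by (simp add: norm_divide)
    ultimately show ?thesis
      using \<phi>[OF z(1)] by simp
  qed
  have d: "0 < cmod c + cmod d"
    using nz[of 0] by (simp add: add_nonneg_pos)
  have deriv: "cmod (a * d - b * c) / (cmod c + cmod d)\<^sup>2 \<le> cmod (deriv \<phi> (z n))" for n
  proof -
    have "(\<phi> has_field_derivative (a * d - b * c) / (c * z n + d)\<^sup>2) (at (z n))"
      by (rule has_field_derivative_transform_within_open[OF moebius_has_field_derivative[OF nz[OF zc(1)]] open_ball z(1)])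
        (simp add: \<phi>)
    then have "cmod (deriv \<phi> (z n)) = cmod (a * d - b * c) / (cmod (c * z n + d))\<^sup>2"
      by (simp add: DERIV_imp_deriv norm_divide norm_power)
    then show ?thesis
      using nz[OF zc(1)[of n]] d norm_affine_le[OF zc(2)]
      by (simp add: divide_left_mono power_mono)
  qed
  have c0: "0 < cmod (a * d - b * c) / (cmod c + cmod d)\<^sup>2"
    using abcd d by (intro divide_pos_pos zero_less_power) auto
  define R where "R n = (\<phi> (z n) - \<psi> (z n)) / of_real (1 - (cmod (\<phi> (z n)))\<^sup>2)" for n
  have R: "R \<longlonglongrightarrow> 0"
    unfolding R_def
    using compact_difference_ratio_tendsto[where z = z, OF \<gamma> T linear_fractional_selfmapD[OF self(1)]
        linear_fractional_selfmapD[OF self(2)] z(1) lim dist c0 deriv] .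
  \<comment> \<open>The numerator of \<open>\<phi> - \<psi>\<close>; \<open>p1\<close> and
    \<open>p2\<close> are its Taylor coefficients at \<open>\<zeta>\<close>.\<close>
  define p where "p z = (a * z + b) * (c' * z + d') - (a' * z + b') * (c * z + d)" for z
  define p2 where "p2 = a * c' - a' * c"
  define p1 where "p1 = 2 * p2 * \<zeta> + (a * d' + b * c' - a' * d - b' * c)"
  have p: "p z = p \<zeta> + p1 * (z - \<zeta>) + p2 * (z - \<zeta>)\<^sup>2" for z
    by (simp add: p_def p1_def p2_def power2_eq_square algebra_simps)
  have "(\<lambda>n. p (z n) / (z n - \<zeta>)\<^sup>2) \<longlonglongrightarrow> 0"
  proof (rule tendsto_norm_zero_cancel, rule tendsto_sandwich[OF _ _ tendsto_const])
    let ?K = "C / m\<^sup>2 * ((cmod c + cmod d) * (cmod c' + cmod d'))"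
    show "(\<lambda>n. cmod (R n) * ?K) \<longlonglongrightarrow> 0"
      using tendsto_mult_left_zero[OF tendsto_norm_zero[OF R]] .
    show "\<forall>\<^sub>F n in sequentially. cmod (p (z n) / (z n - \<zeta>)\<^sup>2) \<le> cmod (R n) * ?K"
    proof (intro always_eventually allI)
      fix n
      have nz2: "c * z n + d \<noteq> 0" "c' * z n + d' \<noteq> 0"
        using nz nz' zc by auto
      have "\<phi> (z n) \<in> ball 0 1"
        using linear_fractional_selfmapD(2)[OF self(1)] z(1) by blast
      then have q: "0 < 1 - (cmod (\<phi> (z n)))\<^sup>2"
        by (simp add: abs_square_less_1)
      have s: "0 < (cmod (z n - \<zeta>))\<^sup>2"
        using z(2) by simp
      have "p (z n) = (\<phi> (z n) - \<psi> (z n)) * ((c * z n + d) * (c' * z n + d'))"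
        unfolding p_def \<phi>[OF z(1)] \<psi>[OF z(1)] using nz2 by (simp add: diff_frac_eq)
      also have "\<phi> (z n) - \<psi> (z n) = R n * of_real (1 - (cmod (\<phi> (z n)))\<^sup>2)"
        using q unfolding R_def by (metis less_irrefl nonzero_eq_divide_eq of_real_eq_0_iff)
      finally have "cmod (p (z n)) = cmod (R n) * ((1 - (cmod (\<phi> (z n)))\<^sup>2) *
          (cmod (c * z n + d) * cmod (c' * z n + d')))"
        using q by (simp only: norm_mult norm_of_real abs_of_pos mult.assoc)
      \<comment> \<open>Here the horocycle enters: \<open>dist\<close> bounds
        \<open>1 - (cmod (\<phi> (z n)))\<^sup>2\<close> by the squared distance to
        \<open>\<zeta>\<close>, which cancels the quotient's denominator.\<close>
      also have "\<dots> \<le> cmod (R n) * ((C / m\<^sup>2 * (cmod (z n - \<zeta>))\<^sup>2) *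
          ((cmod c + cmod d) * (cmod c' + cmod d')))"
        using dist[of n] q d norm_affine_le[OF zc(2)[of n]] C m(1)
        by (intro mult_left_mono mult_mono) (auto simp: horo)
      also have "\<dots> = cmod (R n) * ?K * (cmod (z n - \<zeta>))\<^sup>2"
        by (simp only: mult_ac)
      finally show "cmod (p (z n) / (z n - \<zeta>)\<^sup>2) \<le> cmod (R n) * ?K"
        using s by (simp only: norm_divide norm_power pos_divide_le_eq)
    qed
  qed simp
  then have "(\<lambda>n. (p \<zeta> + p1 * (z n - \<zeta>) + p2 * (z n - \<zeta>)\<^sup>2) / (z n - \<zeta>)\<^sup>2) \<longlonglongrightarrow> 0"
    unfolding p[of "z _"] .
  moreover have "(\<lambda>n. z n - \<zeta>) \<longlonglongrightarrow> 0"
    using z(3) by (rule LIM_zero)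
  ultimately have "p \<zeta> = 0 \<and> p1 = 0 \<and> p2 = 0"
    using z(2) by (intro quadratic_eq_0_if_tendsto[where h = "\<lambda>n. z n - \<zeta>"]) auto
  then have "p u = 0" for u
    using p[of u] by simp
  then show ?thesis
    using nz nz' by (auto simp: \<phi> \<psi> p_def frac_eq_eq)
qed

subsection \<open>Symbols with relatively compact range\<close>

text \<open>The value at 0 is the zeroth coefficient, hence at most the norm; the increment from 0
  is bounded by \<open>deriv_growth\<close>, whose weight stays away from 0 on the smaller
  disc.\<close>

lemma dirichlet_pointwise_bound:
  assumes \<gamma>: "\<gamma> \<ge> -1" and \<rho>: "\<rho> < 1"
  shows "\<exists>B\<ge>0. \<forall>f\<in>dirichlet_space \<gamma>. \<forall>v\<in>cball 0 \<rho>. cmod (f v) \<le> B * dirichlet_norm \<gamma> f"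
proof -
  obtain C where C: "C \<ge> 0" "\<And>f z. f \<in> dirichlet_space \<gamma> \<Longrightarrow> z \<in> ball 0 1 \<Longrightarrow>
      (1 - (cmod z)\<^sup>2) powr (\<gamma> / 2 + 1) * cmod (deriv f z) \<le> C * dirichlet_norm \<gamma> f"
    using deriv_growth[OF \<gamma>] by blast
  define K where "K = C / (1 - \<rho>\<^sup>2) powr (\<gamma> / 2 + 1)"
  show ?thesis
  proof (intro exI[of _ "1 + K"] conjI ballI)
    show "0 \<le> 1 + K"
      using C(1) by (simp add: K_def)
    fix f v assume f: "f \<in> dirichlet_space \<gamma>" and v: "v \<in> cball (0 :: complex) \<rho>"
    let ?N = "dirichlet_norm \<gamma> f"
    have N: "0 \<le> ?N"
      by (rule dirichlet_norm_nonneg[OF f])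
    \<comment> \<open>The sign of \<open>\<rho>\<close> comes from the existence of
      \<open>v\<close>; for negative \<open>\<rho>\<close> the disc is empty.\<close>
    have \<rho>0: "0 \<le> \<rho>"
      using v order_trans[OF norm_ge_zero] by auto
    then have \<rho>2: "0 < 1 - \<rho>\<^sup>2"
      using \<rho> by (simp add: abs_square_less_1)
    have hol: "f holomorphic_on ball 0 1" and sf: "summable (\<lambda>n. (dirichlet_term \<gamma> f n)\<^sup>2)"
      using f by (auto simp: dirichlet_space_iff)
    have "cmod (f v - f 0) \<le> (K * ?N) * cmod (v - 0)"
    proof (rule field_differentiable_bound[where S = "cball 0 \<rho>" and f' = "deriv f"])
      fix z assume z: "z \<in> cball (0 :: complex) \<rho>"
      then have z1: "z \<in> ball 0 1"
        using \<rho> by simp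
      show "(f has_field_derivative deriv f z) (at z within cball 0 \<rho>)"
        by (rule has_field_derivative_at_within[OF holomorphic_derivI[OF hol open_ball z1]])
      have "(cmod z)\<^sup>2 \<le> \<rho>\<^sup>2"
        using z by (intro power_mono) auto
      then have "(1 - \<rho>\<^sup>2) powr (\<gamma> / 2 + 1) * cmod (deriv f z) \<le>
          (1 - (cmod z)\<^sup>2) powr (\<gamma> / 2 + 1) * cmod (deriv f z)"
        using \<rho>2 \<gamma> by (intro mult_right_mono powr_mono2) auto
      also have "\<dots> \<le> C * ?N"
        by (rule C(2)[OF f z1])
      finally show "cmod (deriv f z) \<le> K * ?N"
        using \<rho>2 by (simp add: K_def field_simps)
    qed (use v \<rho>0 in auto)
    also have "\<dots> \<le> (K * ?N) * 1"
      using v \<rho> N C(1) by (intro mult_left_mono) (auto simp: K_def)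
    finally have "cmod (f v - f 0) \<le> K * ?N" by simp
    moreover have "cmod (f 0) \<le> ?N"
    proof -
      have "cmod (f 0) = dirichlet_term \<gamma> f 0"
        by (simp add: dirichlet_term_def taylor_coeff_def fps_expansion_def)
      also have "\<dots> \<le> ?N"
        using L2_dirichlet_le[OF sf, of 1] by (simp add: L2_set_def dirichlet_term_nonneg)
      finally show ?thesis .
    qed
    moreover have "cmod (f v) \<le> cmod (f v - f 0) + cmod (f 0)"
      using norm_triangle_ineq[of "f v - f 0" "f 0"] by simp
    ultimately show "cmod (f v) \<le> (1 + K) * ?N"
      by (simp add: algebra_simps)
  qed
qed

text \<open>Cauchy's estimates on a circle of radius \<open>r > 1\<close> make the coefficients
  decay geometrically, which beats the weight; the latter is at most
  \<open>real (Suc n) powr 2\<close> since \<open>\<gamma> \<ge> -1\<close>.\<close>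

lemma dirichlet_norm_le_sup:
  assumes \<gamma>: "\<gamma> \<ge> -1" and r: "1 < r"
  shows "\<exists>K\<ge>0. \<forall>h S. h holomorphic_on ball 0 r \<longrightarrow> continuous_on (cball 0 r) h \<longrightarrow> 0 \<le> S \<longrightarrow>
    (\<forall>z. cmod z = r \<longrightarrow> cmod (h z) \<le> S) \<longrightarrow>
    (\<lambda>z. if z \<in> ball 0 1 then h z else 0) \<in> dirichlet_space \<gamma> \<and>
    dirichlet_norm \<gamma> (\<lambda>z. if z \<in> ball 0 1 then h z else 0) \<le> K * S"
proof -
  define x where "x = 1 / r\<^sup>2"
  have x: "0 \<le> x" "x < 1"
    using r by (auto simp: x_def)
  then have sum: "summable (\<lambda>n. real (Suc n) powr 2 * x ^ n)"
    using power_weighted_geometric_series[of 2] by auto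
  define A where "A = (\<Sum>n. real (Suc n) powr 2 * x ^ n)"
  have A: "0 \<le> A"
    unfolding A_def using x by (intro suminf_nonneg sum) auto
  show ?thesis
  proof (intro exI[of _ "sqrt (1 + A)"] conjI allI impI)
    show "0 \<le> sqrt (1 + A)"
      using A by simp
    fix h S assume h: "h holomorphic_on ball 0 r" "continuous_on (cball 0 r) h"
      and S: "0 \<le> (S :: real)" "\<forall>z. cmod z = r \<longrightarrow> cmod (h z) \<le> S"
    let ?g = "\<lambda>z. if z \<in> ball 0 1 then h z else 0"
    have hol: "?g holomorphic_on ball 0 1"
      by (rule holomorphic_transform[of h])
        (use r in \<open>auto intro: holomorphic_on_subset[OF h(1)]\<close>)
    have "eventually (\<lambda>z. ?g z = h z) (nhds 0)"
      using eventually_nhds_in_open[of "ball (0 :: complex) 1" 0] by (auto elim!: eventually_mono)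
    then have "taylor_coeff ?g n = (deriv ^^ n) h 0 / fact n" for n
      unfolding taylor_coeff_def by (subst fps_expansion_cong) (simp_all add: fps_expansion_def)
    then have coeff: "cmod (taylor_coeff ?g n) \<le> S / r ^ n" for n
      using Cauchy_inequality[OF h, of S n] S r by (simp add: norm_divide divide_le_eq mult.commute)
    have le: "(dirichlet_term \<gamma> ?g (Suc n))\<^sup>2 \<le> S\<^sup>2 * (real (Suc n) powr 2 * x ^ n)" for n
    proof -
      \<comment> \<open>Gives up one factor \<open>1 / r\<close> so that coefficient
        \<open>Suc n\<close> is compared with the term of index \<open>n\<close>.\<close>
      have "S / r ^ Suc n \<le> S / r ^ n"
        using r S by (intro divide_left_mono power_increasing) auto
      then have "(cmod (taylor_coeff ?g (Suc n)))\<^sup>2 \<le> (S / r ^ n)\<^sup>2"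
        using coeff[of "Suc n"] by (intro power_mono) auto
      also have "\<dots> = S\<^sup>2 * x ^ n"
        by (simp add: x_def power_divide mult.commute flip: power_mult)
      finally have "real (Suc n) powr (1 - \<gamma>) * (cmod (taylor_coeff ?g (Suc n)))\<^sup>2 \<le>
          real (Suc n) powr 2 * (S\<^sup>2 * x ^ n)"
        using \<gamma> by (intro mult_mono powr_mono) auto
      then show ?thesis
        unfolding dirichlet_term_Suc by (simp only: mult_ac)
    qed
    note I = dirichlet_spaceI[OF hol _ le summable_mult[OF sum]]
    show "?g \<in> dirichlet_space \<gamma>"
      by (rule I(1)) simp
    have "dirichlet_norm \<gamma> ?g \<le> sqrt ((cmod (taylor_coeff ?g 0))\<^sup>2 + S\<^sup>2 * A)"
      unfolding A_def suminf_mult[OF sum, symmetric] by (rule I(2)) simp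
    also have "\<dots> \<le> sqrt (S\<^sup>2 + S\<^sup>2 * A)"
      using coeff[of 0] by (intro real_sqrt_le_mono add_right_mono power_mono) auto
    also have "\<dots> = sqrt (1 + A) * S"
    proof -
      have "S\<^sup>2 + S\<^sup>2 * A = (1 + A) * S\<^sup>2"
        by (simp add: algebra_simps)
      then show ?thesis
        using S by (simp add: real_sqrt_mult)
    qed
    finally show "dirichlet_norm \<gamma> ?g \<le> sqrt (1 + A) * S" .
  qed
qed

text \<open>For \<open>f\<close> in the unit ball the functions \<open>f \<circ> F\<close> are
  uniformly bounded on the larger disc. Montel gives a locally uniform limit along a subsequence,
  and \<open>dirichlet_norm_le_sup\<close> upgrades this to norm convergence.\<close>

lemma compact_composition_operator:
  assumes \<gamma>: "\<gamma> \<ge> -1" and R: "1 < R" and \<rho>: "\<rho> < 1"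
    and F: "F holomorphic_on ball 0 R" "F ` ball 0 R \<subseteq> cball 0 \<rho>"
    and \<phi>: "\<And>z. z \<in> ball 0 1 \<Longrightarrow> \<phi> z = F z"
  shows "compact_operator_on_dirichlet \<gamma> (composition_operator \<phi>)"
  unfolding compact_operator_on_dirichlet_sequentially
proof (intro conjI allI impI)
  \<comment> \<open>An intermediate radius: larger than 1 for Cauchy's estimates, smaller than
    \<open>R\<close> so that convergence is uniform on the closed disc of radius
    \<open>r\<close>.\<close>
  define r where "r = (1 + R) / 2"
  have r: "1 < r" "r < R"
    using R by (auto simp: r_def)
  have sub: "cball (0 :: complex) r \<subseteq> ball 0 R" "ball (0 :: complex) r \<subseteq> ball 0 R"
    using r by auto
  obtain B where B0: "B \<ge> 0" and B: "\<And>f v. f \<in> dirichlet_space \<gamma> \<Longrightarrow> v \<in> cball 0 \<rho> \<Longrightarrow>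
      cmod (f v) \<le> B * dirichlet_norm \<gamma> f"
    using dirichlet_pointwise_bound[OF \<gamma> \<rho>] by blast
  let ?E = "\<lambda>h z. if z \<in> ball 0 1 then h z else (0 :: complex)"
  obtain K where K: "K \<ge> 0" and E: "\<And>h S. h holomorphic_on ball 0 R \<Longrightarrow> 0 \<le> S \<Longrightarrow>
      (\<And>z. cmod z = r \<Longrightarrow> cmod (h z) \<le> S) \<Longrightarrow>
      ?E h \<in> dirichlet_space \<gamma> \<and> dirichlet_norm \<gamma> (?E h) \<le> K * S"
  proof -
    obtain K where "K \<ge> 0" and K: "\<forall>h S. h holomorphic_on ball 0 r \<longrightarrow> continuous_on (cball 0 r) h \<longrightarrow> 0 \<le> S \<longrightarrow>
        (\<forall>z. cmod z = r \<longrightarrow> cmod (h z) \<le> S) \<longrightarrow>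
        ?E h \<in> dirichlet_space \<gamma> \<and> dirichlet_norm \<gamma> (?E h) \<le> K * S"
      using dirichlet_norm_le_sup[OF \<gamma> r(1)] by blast
    show thesis
    proof (rule that[OF \<open>K \<ge> 0\<close>])
      fix h S assume h: "h holomorphic_on ball 0 R" and S: "0 \<le> S" "\<And>z. cmod z = r \<Longrightarrow> cmod (h z) \<le> S"
      have "h holomorphic_on ball 0 r" "continuous_on (cball 0 r) h"
        using h sub by (auto intro: holomorphic_on_subset holomorphic_on_imp_continuous_on)
      then show "?E h \<in> dirichlet_space \<gamma> \<and> dirichlet_norm \<gamma> (?E h) \<le> K * S"
        using K S by simp
    qed
  qed
  have comp: "composition_operator \<phi> f = ?E (f \<circ> F)" for f
    by (auto simp: composition_operator_def \<phi> fun_eq_iff)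
  have hol: "f \<circ> F holomorphic_on ball 0 R" if "f \<in> dirichlet_space \<gamma>" for f
  proof (rule holomorphic_on_compose_gen[OF F(1)])
    show "f holomorphic_on ball 0 1"
      using that by (simp add: dirichlet_space_iff)
    show "F ` ball 0 R \<subseteq> ball 0 1"
      using F(2) \<rho> by fastforce
  qed
  have bound: "cmod ((f \<circ> F) z) \<le> B * dirichlet_norm \<gamma> f" if "f \<in> dirichlet_space \<gamma>" "z \<in> ball 0 R" for f z
  proof -
    have "F z \<in> cball 0 \<rho>"
      using F(2) that(2) by blast
    then show ?thesis
      using B[OF that(1)] by simp
  qed
  show "linear_operator_on_dirichlet \<gamma> (composition_operator \<phi>)"
    unfolding linear_operator_on_dirichlet_def
  proof (intro conjI ballI allI Pi_I)
    fix f assume f: "f \<in> dirichlet_space \<gamma>"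
    show "composition_operator \<phi> f \<in> dirichlet_space \<gamma>"
      unfolding comp
      by (rule conjunct1[OF E[OF hol[OF f] mult_nonneg_nonneg[OF B0 dirichlet_norm_nonneg[OF f]] bound[OF f]]])
        (use r in simp)
  qed (auto simp: composition_operator_def)
  fix f :: "nat \<Rightarrow> complex \<Rightarrow> complex"
  assume f: "\<forall>n. f n \<in> dirichlet_space \<gamma> \<and> dirichlet_norm \<gamma> (f n) \<le> 1"
  define H where "H = {h. h holomorphic_on ball 0 R \<and> (\<forall>z\<in>ball 0 R. cmod (h z) \<le> B)}"
  have H: "f n \<circ> F \<in> H" for n
  proof -
    have "B * dirichlet_norm \<gamma> (f n) \<le> B * 1"
      using f B0 by (intro mult_left_mono) auto
    then show ?thesis
      using f hol[of "f n"] bound[of "f n"] by (fastforce simp: H_def)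
  qed
  obtain g s where g: "g holomorphic_on ball 0 R" and s: "strict_mono s"
    and lim: "\<And>z. z \<in> ball 0 R \<Longrightarrow> (\<lambda>n. (f (s n) \<circ> F) z) \<longlonglongrightarrow> g z"
    and unif: "\<And>K. compact K \<Longrightarrow> K \<subseteq> ball 0 R \<Longrightarrow> uniform_limit K ((\<lambda>n. f n \<circ> F) \<circ> s) g sequentially"
  proof (rule Montel[of "ball 0 R" H "\<lambda>n. f n \<circ> F"])
    show "\<exists>B. \<forall>h\<in>H. \<forall>z\<in>K. cmod (h z) \<le> B" if "K \<subseteq> ball 0 R" for K
      using that by (auto simp: H_def)
  qed (use H in \<open>auto simp: H_def\<close>)
  have gB: "cmod (g z) \<le> B" if "z \<in> ball 0 R" for z
    using H that by (intro tendsto_upperbound[OF tendsto_norm[OF lim[OF that]]]) (auto simp: H_def)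
  have G: "?E g \<in> dirichlet_space \<gamma>"
    using r by (intro conjunct1[OF E[OF g B0 gB]]) simp
  have diff: "(\<lambda>z. composition_operator \<phi> (f n) z - ?E g z) = ?E (\<lambda>z. (f n \<circ> F) z - g z)" for n
    by (auto simp: comp)
  have "(\<lambda>n. dirichlet_norm \<gamma> (\<lambda>z. composition_operator \<phi> (f (s n)) z - ?E g z)) \<longlonglongrightarrow> 0"
  proof (rule tendstoI)
    fix e :: real assume e: "e > 0"
    \<comment> \<open>\<open>K + 1\<close> replaces \<open>K\<close>, which may be 0.\<close>
    define e' where "e' = e / (K + 1)"
    have e': "e' > 0" "K * e' < e"
      using e K by (auto simp: e'_def field_simps)
    have "\<forall>\<^sub>F n in sequentially. \<forall>z\<in>cball 0 r. dist (((\<lambda>n. f n \<circ> F) \<circ> s) n z) (g z) < e'"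
      using uniform_limitD[OF unif[OF compact_cball sub(1)] e'(1)] .
    then show "\<forall>\<^sub>F n in sequentially.
        dist (dirichlet_norm \<gamma> (\<lambda>z. composition_operator \<phi> (f (s n)) z - ?E g z)) 0 < e"
    proof eventually_elim
      case (elim n)
      have "(\<lambda>z. (f (s n) \<circ> F) z - g z) holomorphic_on ball 0 R"
        using f hol[of "f (s n)"] by (intro holomorphic_on_diff g) (simp add: comp_def)
      then have *: "?E (\<lambda>z. (f (s n) \<circ> F) z - g z) \<in> dirichlet_space \<gamma> \<and>
          dirichlet_norm \<gamma> (?E (\<lambda>z. (f (s n) \<circ> F) z - g z)) \<le> K * e'"
        using elim e'(1) by (intro E) (auto simp: dist_norm less_imp_le)
      then show ?case
        unfolding diff using dirichlet_norm_nonneg e'(2) by fastforce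
    qed
  qed
  with s G show "\<exists>r g. strict_mono r \<and> g \<in> dirichlet_space \<gamma> \<and>
      (\<lambda>n. dirichlet_norm \<gamma> (\<lambda>z. composition_operator \<phi> (f (r n)) z - g z)) \<longlonglongrightarrow> 0"
    by blast
qed

text \<open>By compactness of the closed disc the strict inequality holds with a factor
  \<open>\<rho> < 1\<close>, and it persists on a slightly larger disc.\<close>

lemma compact_composition_operator_linear_fractional:
  fixes a b c d :: complex
  assumes \<gamma>: "\<gamma> \<ge> -1"
    and \<phi>: "\<And>z. z \<in> ball 0 1 \<Longrightarrow> \<phi> z = (a * z + b) / (c * z + d)"
    and less: "\<And>z. z \<in> cball 0 1 \<Longrightarrow> cmod (a * z + b) < cmod (c * z + d)"
  shows "compact_operator_on_dirichlet \<gamma> (composition_operator \<phi>)"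
proof -
  define F where "F z = (a * z + b) / (c * z + d)" for z
  have nz: "c * z + d \<noteq> 0" if "z \<in> cball 0 1" for z
    using less[OF that] by auto
  have "continuous_on (cball 0 1) (\<lambda>z. cmod (F z))"
    unfolding F_def using nz by (intro continuous_intros) auto
  then obtain z0 where z0: "z0 \<in> cball 0 1" "\<And>z. z \<in> cball 0 1 \<Longrightarrow> cmod (F z) \<le> cmod (F z0)"
    using continuous_attains_sup[of "cball (0 :: complex) 1"] by fastforce
  have "cmod (F z0) < 1"
    using less[OF z0(1)] nz[OF z0(1)] by (simp add: F_def norm_divide)
  then obtain \<rho> where \<rho>: "cmod (F z0) < \<rho>" "\<rho> < 1"
    using dense by blast
  \<comment> \<open>The condition \<open>cmod (F z) < \<rho>\<close> with the denominator cleared: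
    it is visibly open, and membership forces \<open>c * z + d \<noteq> 0\<close>.\<close>
  define U where "U = {z. cmod (a * z + b) < \<rho> * cmod (c * z + d)}"
  have "open U"
    unfolding U_def by (intro open_Collect_less continuous_intros)
  moreover have "cball 0 1 \<subseteq> U"
  proof
    fix z assume z: "z \<in> cball (0 :: complex) 1"
    then have "cmod (F z) < \<rho>"
      using z0(2) \<rho>(1) by force
    then show "z \<in> U"
      using nz[OF z] by (simp add: U_def F_def norm_divide divide_less_eq)
  qed
  ultimately obtain e where e: "e > 0" "(\<Union>z\<in>cball 0 1. cball z e) \<subseteq> U"
    using compact_subset_open_imp_cball_epsilon_subset[OF compact_cball] by blast
  have "ball 0 (1 + e) \<subseteq> U"
  proof
    fix z assume z: "z \<in> ball (0 :: complex) (1 + e)"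
    show "z \<in> U"
    proof (cases "cmod z \<le> 1")
      case True
      then show ?thesis
        using \<open>cball 0 1 \<subseteq> U\<close> by auto
    next
      case False
      then have "z \<noteq> 0" by auto
      \<comment> \<open>\<open>sgn z\<close> is the radial projection of \<open>z\<close> to the
        unit circle, so \<open>z\<close> lies within \<open>e\<close> of the closed disc.\<close>
      then have "dist (sgn z) z = \<bar>1 - cmod z\<bar>"
      proof -
        have "sgn z - z = of_real (1 - cmod z) * sgn z"
          using \<open>z \<noteq> 0\<close> by (simp add: sgn_eq left_diff_distrib diff_divide_distrib)
        then show ?thesis
          using \<open>z \<noteq> 0\<close> by (simp add: dist_norm norm_mult norm_sgn del: of_real_diff)
      qed
      then have "z \<in> cball (sgn z) e" "sgn z \<in> cball 0 1"
        using z False by (auto simp: norm_sgn)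
      then show ?thesis
        using e(2) by blast
    qed
  qed
  then have U: "cmod (a * z + b) < \<rho> * cmod (c * z + d)" "c * z + d \<noteq> 0" if "z \<in> ball 0 (1 + e)" for z
    using that by (auto simp: U_def subset_iff)
  show ?thesis
  proof (rule compact_composition_operator[OF \<gamma> _ \<rho>(2)])
    show "1 < 1 + e"
      using e(1) by simp
    show "F holomorphic_on ball 0 (1 + e)"
      unfolding F_def using U(2) by (intro holomorphic_intros) auto
    show "F ` ball 0 (1 + e) \<subseteq> cball 0 \<rho>"
      using U by (auto simp: F_def norm_divide divide_le_eq less_imp_le)
    show "\<phi> z = F z" if "z \<in> ball 0 1" for z
      using \<phi>[OF that] by (simp add: F_def)
  qed
qed

text \<open>Contact with the unit circle would make the symbols equal, so the weak inequality on the
  closed disc is strict and the range of \<open>\<phi>\<close> stays away from the circle.\<close>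

lemma compact_composition_operator_if_compact_difference:
  assumes \<gamma>: "\<gamma> \<ge> -1"
    and self: "linear_fractional_selfmap \<phi>" "linear_fractional_selfmap \<psi>"
    and T: "compact_operator_on_dirichlet \<gamma>
      (\<lambda>f z. composition_operator \<phi> f z - composition_operator \<psi> f z)"
    and ne: "\<not> (\<forall>z\<in>ball 0 1. \<phi> z = \<psi> z)"
  shows "compact_operator_on_dirichlet \<gamma> (composition_operator \<phi>)"
proof -
  obtain a b c d where abcd: "a * d - b * c \<noteq> 0"
    and \<phi>: "\<And>z. z \<in> ball 0 1 \<Longrightarrow> \<phi> z = (a * z + b) / (c * z + d)"
    and less: "\<And>z. z \<in> ball 0 1 \<Longrightarrow> cmod (a * z + b) < cmod (c * z + d)"
    and le: "\<And>z. z \<in> cball 0 1 \<Longrightarrow> cmod (a * z + b) \<le> cmod (c * z + d)"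
    and nz: "\<And>z. z \<in> cball 0 1 \<Longrightarrow> c * z + d \<noteq> 0"
    using linear_fractional_selfmapE[OF self(1)] by metis
  have "cmod (a * z + b) < cmod (c * z + d)" if z: "z \<in> cball 0 1" for z
  proof (rule ccontr)
    assume "\<not> cmod (a * z + b) < cmod (c * z + d)"
    then have "cmod (a * z + b) = cmod (c * z + d)" "cmod z = 1"
      using le[OF z] less[of z] z by force+
    then show False
      using eq_if_compact_difference_contact[OF \<gamma> T self abcd \<phi> le nz] ne by blast
  qed
  with \<gamma> \<phi> show ?thesis
    by (rule compact_composition_operator_linear_fractional)
qed

text \<open>Settles the case of equal symbols, and serves as minuend when a compact operator is
  negated.\<close>

lemma compact_operator_on_dirichlet_zero:
  "compact_operator_on_dirichlet \<gamma> (\<lambda>f z. 0)"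
proof -
  have c: "taylor_coeff (\<lambda>z. 0) n = 0" for n
    by (rule taylor_coeff_eqI) simp
  have D: "(\<lambda>z. 0) \<in> dirichlet_space \<gamma>"
    by (simp add: dirichlet_space_def c)
  have "strict_mono (id :: nat \<Rightarrow> nat) \<and> (\<lambda>z. 0) \<in> dirichlet_space \<gamma> \<and>
      (\<lambda>n :: nat. dirichlet_norm \<gamma> (\<lambda>z. 0 - 0)) \<longlonglongrightarrow> 0"
    using D by (simp add: strict_mono_def dirichlet_norm_def c)
  then have "\<exists>(r :: nat \<Rightarrow> nat) g. strict_mono r \<and> g \<in> dirichlet_space \<gamma> \<and>
      (\<lambda>n :: nat. dirichlet_norm \<gamma> (\<lambda>z. 0 - g z)) \<longlonglongrightarrow> 0"
    by blast
  then show ?thesis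
    unfolding compact_operator_on_dirichlet_sequentially linear_operator_on_dirichlet_def
    using D by simp
qed

theorem corollary3p7:
  fixes \<phi> \<psi> :: "complex \<Rightarrow> complex" and \<gamma> :: real
  assumes "linear_fractional_selfmap \<phi>" and "linear_fractional_selfmap \<psi>"
    and "\<gamma> \<ge> -1"
  shows "compact_operator_on_dirichlet \<gamma>
           (\<lambda>f z. composition_operator \<phi> f z - composition_operator \<psi> f z) \<longleftrightarrow>
         (\<forall>z\<in>ball 0 1. \<phi> z = \<psi> z) \<or>
         (compact_operator_on_dirichlet \<gamma> (composition_operator \<phi>) \<and>
          compact_operator_on_dirichlet \<gamma> (composition_operator \<psi>))"
proof -
  let ?T = "compact_operator_on_dirichlet \<gamma>
      (\<lambda>f z. composition_operator \<phi> f z - composition_operator \<psi> f z)"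
  let ?eq = "\<forall>z\<in>ball 0 1. \<phi> z = \<psi> z"
  let ?both = "compact_operator_on_dirichlet \<gamma> (composition_operator \<phi>) \<and>
      compact_operator_on_dirichlet \<gamma> (composition_operator \<psi>)"
  have ?T if "?eq \<or> ?both"
    using that
  proof
    assume ?eq
    then have "(\<lambda>f z. composition_operator \<phi> f z - composition_operator \<psi> f z) = (\<lambda>f z. 0)"
      by (auto simp: composition_operator_def fun_eq_iff)
    then show ?T
      using compact_operator_on_dirichlet_zero by simp
  next
    assume ?both
    then show ?T
      by (auto intro: compact_operator_on_dirichlet_diff)
  qed
  moreover have "?eq \<or> ?both" if T: ?T
  proof -
    \<comment> \<open>The preceding results treat the first symbol only; negating the operator
      exchanges the roles of \<open>\<phi>\<close> and \<open>\<psi>\<close>.\<close>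
    have "compact_operator_on_dirichlet \<gamma> (\<lambda>f z. 0 - (composition_operator \<phi> f z - composition_operator \<psi> f z))"
      using compact_operator_on_dirichlet_zero T by (rule compact_operator_on_dirichlet_diff)
    then have T': "compact_operator_on_dirichlet \<gamma>
        (\<lambda>f z. composition_operator \<psi> f z - composition_operator \<phi> f z)"
      by simp
    show ?thesis
      using compact_composition_operator_if_compact_difference[OF assms(3,1,2) T]
        compact_composition_operator_if_compact_difference[OF assms(3,2,1) T'] by metis
  qed
  ultimately show ?thesis by blast
qed

end
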